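(* Let $n\geq 4$ and let $d$ be a non-negative integer with $d<\left\lfloor \frac{n}{2}\right\rfloor$. Then $\mathrm{Aut}(W_n)$ has property $\mathrm{F}\mathcal{A}_d$: every action of $\mathrm{Aut}(W_n)$ by isometries on a complete $\mathrm{CAT}(0)$ space of covering dimension $d$ has a global fixed point.
   Context: $W_n$ denotes the universal Coxeter group of rank $n$, $W_n=\langle s_1,\dots,s_n\mid s_1^2,\dots,s_n^2\rangle\cong \mathbb{Z}_2*\cdots*\mathbb{Z}_2$ ($n$ factors), and $\mathrm{Aut}(W_n)$ its automorphism group. A group $G$ has property $\mathrm{F}\mathcal{A}_d$ if any action of $G$ by isometries on a complete $\mathrm{CAT}(0)$ space of covering dimension $d$ has a fixed point. *)

theory Defs
  imports "HOL-Analysis.Analysis" "HOL-Algebra.Group_Action"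
begin

text \<open>Elements of W_n are represented by their (unique) reduced words over the
generators s_0,...,s_(n-1): lists of letters < n without two equal adjacent letters.
Multiplication is concatenation followed by cancellation of adjacent equal letters
(s_i^2 = 1).\<close>

definition reduced_word :: "nat \<Rightarrow> nat list \<Rightarrow> bool" where
  "reduced_word n w \<longleftrightarrow> set w \<subseteq> {..<n} \<and> (\<forall>i. Suc i < length w \<longrightarrow> w ! i \<noteq> w ! Suc i)"

fun push_letter :: "nat \<Rightarrow> nat list \<Rightarrow> nat list" where
  "push_letter a [] = [a]"
| "push_letter a (b # w) = (if a = b then w else a # b # w)"

definition word_mult :: "nat list \<Rightarrow> nat list \<Rightarrow> nat list" where
  "word_mult u v = foldr push_letter u v"

definition UCox :: "nat \<Rightarrow> nat list monoid" where
  "UCox n = \<lparr>carrier = {w. reduced_word n w}, mult = word_mult, one = []\<rparr>"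

definition geodesic_path :: "'x set \<Rightarrow> ('x \<Rightarrow> 'x \<Rightarrow> real) \<Rightarrow> (real \<Rightarrow> 'x) \<Rightarrow> 'x \<Rightarrow> 'x \<Rightarrow> bool" where
  "geodesic_path M d \<gamma> x y \<longleftrightarrow>
     \<gamma> 0 = x \<and> \<gamma> (d x y) = y \<and> \<gamma> ` {0..d x y} \<subseteq> M \<and>
     (\<forall>s\<in>{0..d x y}. \<forall>t\<in>{0..d x y}. d (\<gamma> s) (\<gamma> t) = \<bar>s - t\<bar>)"

definition geodesic_space :: "'x set \<Rightarrow> ('x \<Rightarrow> 'x \<Rightarrow> real) \<Rightarrow> bool" where
  "geodesic_space M d \<longleftrightarrow> (\<forall>x\<in>M. \<forall>y\<in>M. \<exists>\<gamma>. geodesic_path M d \<gamma> x y)"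

text \<open>Comparison point on the Euclidean segment from p' to q' (of length L) at distance s
from p'. The Euclidean plane is modelled by the complex numbers.\<close>

definition comparison_point :: "complex \<Rightarrow> complex \<Rightarrow> real \<Rightarrow> real \<Rightarrow> complex" where
  "comparison_point p' q' L s = p' + complex_of_real (s / L) * (q' - p')"

definition side_pairs :: "(real \<Rightarrow> 'x) \<Rightarrow> real \<Rightarrow> complex \<Rightarrow> complex \<Rightarrow> ('x \<times> complex) set" where
  "side_pairs \<gamma> L p' q' = {(\<gamma> s, comparison_point p' q' L s) | s. 0 \<le> s \<and> s \<le> L}"

definition CAT0_space :: "'x set \<Rightarrow> ('x \<Rightarrow> 'x \<Rightarrow> real) \<Rightarrow> bool" where
  "CAT0_space M d \<longleftrightarrow> Metric_space M d \<and> geodesic_space M d \<and>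
    (\<forall>p\<in>M. \<forall>q\<in>M. \<forall>r\<in>M. \<forall>\<gamma>1 \<gamma>2 \<gamma>3 p' q' r'.
       geodesic_path M d \<gamma>1 p q \<and> geodesic_path M d \<gamma>2 q r \<and> geodesic_path M d \<gamma>3 r p \<and>
       dist p' q' = d p q \<and> dist q' r' = d q r \<and> dist r' p' = d r p \<longrightarrow>
       (let T = side_pairs \<gamma>1 (d p q) p' q' \<union> side_pairs \<gamma>2 (d q r) q' r' \<union>
                side_pairs \<gamma>3 (d r p) r' p'
        in \<forall>(a, a')\<in>T. \<forall>(b, b')\<in>T. d a b \<le> dist a' b'))"

text \<open>dim X \<le> k (k \<ge> -1): every finite open cover has a finite open refinement
in which every point lies in at most k+1 members (Cech-Lebesgue covering dimension).\<close>

definition covering_dim_le :: "'x topology \<Rightarrow> int \<Rightarrow> bool" where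
  "covering_dim_le X k \<longleftrightarrow>
    (\<forall>\<U>. finite \<U> \<and> (\<forall>U\<in>\<U>. openin X U) \<and> \<Union>\<U> = topspace X \<longrightarrow>
      (\<exists>\<V>. finite \<V> \<and> (\<forall>V\<in>\<V>. openin X V) \<and> \<Union>\<V> = topspace X \<and>
           (\<forall>V\<in>\<V>. \<exists>U\<in>\<U>. V \<subseteq> U) \<and>
           (\<forall>x\<in>topspace X. int (card {V\<in>\<V>. x \<in> V}) \<le> k + 1)))"

definition covering_dim_eq :: "'x topology \<Rightarrow> nat \<Rightarrow> bool" where
  "covering_dim_eq X d \<longleftrightarrow> covering_dim_le X (int d) \<and> \<not> covering_dim_le X (int d - 1)"

definition isometric_action ::
  "('g, 'c) monoid_scheme \<Rightarrow> 'x set \<Rightarrow> ('x \<Rightarrow> 'x \<Rightarrow> real) \<Rightarrow> ('g \<Rightarrow> 'x \<Rightarrow> 'x) \<Rightarrow> bool" where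
  "isometric_action G M d \<rho> \<longleftrightarrow> group_action G M \<rho> \<and>
     (\<forall>g\<in>carrier G. \<forall>x\<in>M. \<forall>y\<in>M. d (\<rho> g x) (\<rho> g y) = d x y)"

definition has_fixed_point :: "('g, 'c) monoid_scheme \<Rightarrow> 'x set \<Rightarrow> ('g \<Rightarrow> 'x \<Rightarrow> 'x) \<Rightarrow> bool" where
  "has_fixed_point G M \<rho> \<longleftrightarrow> (\<exists>x\<in>M. \<forall>g\<in>carrier G. \<rho> g x = x)"

end

theory Submission
  imports Defs "HOL-Library.Sublist" "HOL-Combinatorics.Permutations"
begin

text \<open>For \<open>2 \<le> q \<le> n\<close> the group \<open>Aut(W_q)\<close> is generated by \<open>q\<close> involutions: one partial
conjugation and the \<open>q - 1\<close> adjacent transpositions. By induction on \<open>q\<close> every copy of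
\<open>Aut(W_q)\<close> on a block of letters fixes a point. Omitting one generator leaves a finite group, or
the product of a smaller copy with a commuting finite group, so there is a fixed point by the
Bruhat-Tits theorem and the induction hypothesis. If \<open>Aut(W_q)\<close> itself had no fixed point, then
the fixed sets of the generators of \<open>n div q\<close> commuting copies would give a map from a product of
\<open>n div q\<close> simplices of dimension \<open>q - 1\<close> that is essential, which forces the covering
dimension to be at least \<open>n div q * (q - 1) \<ge> n div 2\<close>.\<close>

subsection \<open>The Poincare-Miranda theorem\<close>

text \<open>A single copy without fixed point only forces dimension \<open>q - 1\<close>, too little
  for small \<open>q\<close>. Disjoint blocks repair this: permutations of letters conjugate them,
  so all \<open>n div q\<close> copies fail at once, and since they commute, their fixed sets
  satisfy a product form of the Helly condition: in each block the \<open>q\<close> sets have no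
  common point, but after dropping one set in every block, chosen independently, the rest still
  meet. The estimate \<open>n div 2\<close> is attained at \<open>q = 2\<close>, which is the origin
  of the bound in the theorem. Essentiality is obtained without homology. Geodesics fill the product
  of simplices continuously; each simplex is parametrised by a cube, so that the Poincare-Miranda
  theorem applies; and the outcome is a point lying in too many members of any finite open
  refinement of a cover by complements of fixed sets. Fixed points are sought for generating sets,
  never for the subgroups themselves. Only at the very end is it needed that the block of all
  letters generates the whole group, and this is Nielsen reduction.\<close>

lemma kuhn_pair:
  fixes F :: "'i \<Rightarrow> ('i \<Rightarrow> real) \<Rightarrow> real" and p :: nat
  assumes I: "finite I" and p: "p > 0"
    and lo: "\<And>i t. i \<in> I \<Longrightarrow> t \<in> UNIV \<rightarrow> {0..1} \<Longrightarrow> t i = 0 \<Longrightarrow> F i t \<le> 0"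
    and hi: "\<And>i t. i \<in> I \<Longrightarrow> t \<in> UNIV \<rightarrow> {0..1} \<Longrightarrow> t i = 1 \<Longrightarrow> F i t \<ge> 0"
  obtains c r s where "c \<in> UNIV \<rightarrow> {0..1}"
    and "\<And>i. i \<in> I \<Longrightarrow> F i (r i) \<le> 0 \<and> F i (s i) \<ge> 0"
    and "\<And>i j. i \<in> I \<Longrightarrow> \<bar>r i j - c j\<bar> \<le> 1 / real p \<and> \<bar>s i j - c j\<bar> \<le> 1 / real p"
proof -
  obtain e where e: "bij_betw e {..<card I} I"
    using ex_bij_betw_nat_finite[OF I] by (auto simp: atLeast0LessThan)
  let ?n = "card I"
  \<comment> \<open>\<open>min p\<close> and the default 0 outside \<open>I\<close> keep
    \<open>pt x\<close> in the cube for every lattice point \<open>x\<close>.\<close>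
  define pt :: "(nat \<Rightarrow> nat) \<Rightarrow> 'i \<Rightarrow> real" where
    "pt x i = (if i \<in> I then real (min p (x (the_inv_into {..<?n} e i))) / p else 0)" for x i
  have pt_e: "pt x (e i) = real (min p (x i)) / p" if "i < ?n" for x i
    using that e by (auto simp: pt_def bij_betw_def the_inv_into_f_f)
  have pt_in: "pt x \<in> UNIV \<rightarrow> {0..1}" for x
    using p by (auto simp: pt_def)
  \<comment> \<open>The label is the sign of \<open>F (e i)\<close>, except on the two opposite
    faces, where Kuhn's lemma prescribes it; \<open>lo\<close> and \<open>hi\<close> make the
    prescribed labels agree with the weak signs.\<close>
  define label where
    "label x i = (if x i = 0 then 0 else if x i = p then 1 else if F (e i) (pt x) \<le> 0 then 0 else (1::nat))"
    for x i
  have lab0: "F (e i) (pt x) \<le> 0" if "i < ?n" "label x i = 0" for x i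
  proof (cases "x i = 0")
    case True
    then show ?thesis using lo[of "e i" "pt x"] pt_in pt_e[OF that(1), of x] e that by (auto simp: bij_betw_def)
  qed (use that in \<open>auto simp: label_def split: if_splits\<close>)
  have lab1: "F (e i) (pt x) \<ge> 0" if "i < ?n" "label x i \<noteq> 0" for x i
  proof (cases "x i = p")
    case True
    then show ?thesis using hi[of "e i" "pt x"] pt_in pt_e[OF that(1), of x] e that p
      by (auto simp: bij_betw_def)
  qed (use that in \<open>auto simp: label_def split: if_splits\<close>)
  obtain q where q: "\<forall>i<?n. q i < p"
    and rs: "\<forall>i<?n. \<exists>r s. (\<forall>j<?n. q j \<le> r j \<and> r j \<le> q j + 1) \<and>
       (\<forall>j<?n. q j \<le> s j \<and> s j \<le> q j + 1) \<and> label r i \<noteq> label s i"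
    by (rule kuhn_lemma[of p ?n label]) (use p in \<open>auto simp: label_def\<close>)
  have close: "\<bar>pt r j - pt q j\<bar> \<le> 1 / p" if "\<forall>j<?n. q j \<le> r j \<and> r j \<le> q j + 1" for r j
  proof (cases "j \<in> I")
    case True
    then obtain k where k: "k < ?n" "j = e k" using e by (auto simp: bij_betw_def)
    have "\<bar>real (min p (r k)) - real (min p (q k))\<bar> \<le> 1"
      using that k by (auto simp: min_def abs_le_iff)
    then show ?thesis using p unfolding k(2) pt_e[OF k(1)]
      by (simp add: abs_divide divide_right_mono flip: diff_divide_distrib)
  qed (auto simp: pt_def)
  have "\<exists>r s. F i r \<le> 0 \<and> F i s \<ge> 0 \<and> (\<forall>j. \<bar>r j - pt q j\<bar> \<le> 1 / p \<and> \<bar>s j - pt q j\<bar> \<le> 1 / p)"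
    if iI: "i \<in> I" for i
  proof -
    obtain k where k: "k < ?n" "i = e k" using e iI by (auto simp: bij_betw_def)
    obtain r s where r: "\<forall>j<?n. q j \<le> r j \<and> r j \<le> q j + 1"
      and s: "\<forall>j<?n. q j \<le> s j \<and> s j \<le> q j + 1" and ne: "label r k \<noteq> label s k"
      using rs k(1) by blast
    show ?thesis
    proof (cases "label r k = 0")
      case True
      then have "F i (pt r) \<le> 0" "F i (pt s) \<ge> 0" using lab0 lab1 ne k by auto
      then show ?thesis using close[OF r] close[OF s] by blast
    next
      case False
      then have "label s k = 0" using ne by (auto simp: label_def split: if_splits)
      then have "F i (pt s) \<le> 0" "F i (pt r) \<ge> 0" using lab0 lab1 False k by auto
      then show ?thesis using close[OF r] close[OF s] by blast
    qed
  qed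
  then obtain r s where "\<And>i. i \<in> I \<Longrightarrow> F i (r i) \<le> 0 \<and> F i (s i) \<ge> 0 \<and>
      (\<forall>j. \<bar>r i j - pt q j\<bar> \<le> 1 / p \<and> \<bar>s i j - pt q j\<bar> \<le> 1 / p)"
    by metis
  then show ?thesis using that[of "pt q" r s] pt_in by blast
qed

lemma compact_function_cube: "compact (UNIV \<rightarrow> {0..1::real} :: ('i \<Rightarrow> real) set)"
proof -
  have "compactin (product_topology (\<lambda>_::'i. euclidean :: real topology) UNIV) (PiE UNIV (\<lambda>_. {0..1}))"
    by (simp add: compactin_PiE)
  then show ?thesis
    by (simp add: euclidean_product_topology PiE_UNIV_domain)
qed

lemma tendsto_fun_coordinates:
  fixes f :: "'a \<Rightarrow> 'i::countable \<Rightarrow> real"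
  assumes "\<And>i. ((\<lambda>x. f x i) \<longlongrightarrow> l i) F"
  shows "(f \<longlongrightarrow> l) F"
proof -
  have "limitin (product_topology (\<lambda>_. euclidean) UNIV) f l F"
    using assms by (simp add: limitin_componentwise)
  then show ?thesis
    by (simp add: euclidean_product_topology)
qed

text \<open>As the mesh tends to 0 the Kuhn cells accumulate at a point, where both weak
  inequalities survive. Countability of the index type makes the function space first countable, so
  compactness gives a convergent subsequence.\<close>

theorem poincare_miranda:
  fixes F :: "'i::countable \<Rightarrow> ('i \<Rightarrow> real) \<Rightarrow> real"
  assumes I: "finite I"
    and cont: "\<And>i. i \<in> I \<Longrightarrow> continuous_on UNIV (F i)"
    and lo: "\<And>i t. i \<in> I \<Longrightarrow> t \<in> UNIV \<rightarrow> {0..1} \<Longrightarrow> t i = 0 \<Longrightarrow> F i t \<le> 0"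
    and hi: "\<And>i t. i \<in> I \<Longrightarrow> t \<in> UNIV \<rightarrow> {0..1} \<Longrightarrow> t i = 1 \<Longrightarrow> F i t \<ge> 0"
  obtains t where "t \<in> UNIV \<rightarrow> {0..1}" "\<And>i. i \<in> I \<Longrightarrow> F i t = 0"
proof -
  have "\<exists>c r s. c \<in> UNIV \<rightarrow> {0..1} \<and> (\<forall>i\<in>I. F i (r i) \<le> 0 \<and> F i (s i) \<ge> 0 \<and>
      (\<forall>j. \<bar>r i j - c j\<bar> \<le> 1 / real (Suc m) \<and> \<bar>s i j - c j\<bar> \<le> 1 / real (Suc m)))" for m
    by (rule kuhn_pair[OF I, of "Suc m" F]) (use lo hi in blast)+
  then obtain c r s where c: "\<And>m. c m \<in> UNIV \<rightarrow> {0..1}"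
    and rs: "\<And>m i. i \<in> I \<Longrightarrow> F i (r m i) \<le> 0 \<and> F i (s m i) \<ge> 0 \<and>
      (\<forall>j. \<bar>r m i j - c m j\<bar> \<le> 1 / real (Suc m) \<and> \<bar>s m i j - c m j\<bar> \<le> 1 / real (Suc m))"
    by metis
  have "seq_compact (UNIV \<rightarrow> {0..1::real} :: ('i \<Rightarrow> real) set)"
    using compact_function_cube compact_imp_seq_compact by blast
  then obtain t h where t: "t \<in> UNIV \<rightarrow> {0..1}" and h: "strict_mono (h :: nat \<Rightarrow> nat)"
    and lim: "(c \<circ> h) \<longlonglongrightarrow> t"
    using c unfolding seq_compact_def by metis
  have limj: "(\<lambda>m. c (h m) j) \<longlonglongrightarrow> t j" for j
  proof -
    have "continuous_on UNIV (\<lambda>u::'i \<Rightarrow> real. u j)" by simp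
    from continuous_on_tendsto_compose[OF this lim] show ?thesis by (simp add: o_def)
  qed
  have inv0: "(\<lambda>m. 1 / real (Suc (h m))) \<longlonglongrightarrow> 0"
    using LIMSEQ_subseq_LIMSEQ[OF lim_inverse_n' [THEN LIMSEQ_Suc] h] by (simp add: o_def)
  have near: "(\<lambda>m. x (h m)) \<longlonglongrightarrow> t"
    if "\<And>m j. \<bar>x m j - c m j\<bar> \<le> 1 / real (Suc m)" for x :: "nat \<Rightarrow> 'i \<Rightarrow> real"
  proof (rule tendsto_fun_coordinates)
    fix j
    have "(\<lambda>m. x (h m) j - c (h m) j) \<longlonglongrightarrow> 0"
      by (rule Lim_null_comparison[OF _ inv0]) (use that in auto)
    from tendsto_add[OF this limj[of j]] show "(\<lambda>m. x (h m) j) \<longlonglongrightarrow> t j" by simp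
  qed
  have "F i t = 0" if i: "i \<in> I" for i
  proof (rule antisym)
    have "(\<lambda>m. F i (r (h m) i)) \<longlonglongrightarrow> F i t"
      by (rule continuous_on_tendsto_compose[OF cont[OF i] near]) (use rs[OF i] in auto)
    then show "F i t \<le> 0" by (rule LIMSEQ_le_const2) (use rs[OF i] in auto)
    have "(\<lambda>m. F i (s (h m) i)) \<longlonglongrightarrow> F i t"
      by (rule continuous_on_tendsto_compose[OF cont[OF i] near]) (use rs[OF i] in auto)
    then show "0 \<le> F i t" by (rule LIMSEQ_le_const) (use rs[OF i] in auto)
  qed
  then show ?thesis using that t by blast
qed

subsection \<open>Geodesics and centres in CAT(0) spaces\<close>

text \<open>\<open>CAT0_space\<close> speaks about given comparison triangles, so one has to be
  produced before it can be applied.\<close>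

lemma complex_triangle_exists:
  fixes a b c :: real
  assumes "0 \<le> a" "0 \<le> b" "0 \<le> c" "a \<le> b + c" "b \<le> a + c" "c \<le> a + b"
  obtains p q r :: complex where "dist p q = c" "dist q r = a" "dist r p = b"
proof (cases "c = 0")
  case True
  then show ?thesis using assms by (intro that[of 0 0 "of_real a"]) (auto simp: dist_norm)
next
  case False
  then have c: "c > 0" using assms by simp
  \<comment> \<open>Law of cosines: with two vertices at 0 and \<open>c\<close>, this is the
    abscissa of the vertex at distance \<open>b\<close> from 0 and \<open>a\<close> from
    \<open>c\<close>.\<close>
  define x where "x = (b\<^sup>2 + c\<^sup>2 - a\<^sup>2) / (2 * c)"
  have "\<bar>b\<^sup>2 + c\<^sup>2 - a\<^sup>2\<bar> \<le> 2 * b * c"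
  proof -
    have "(b - c)\<^sup>2 \<le> a\<^sup>2" using assms by (intro abs_le_square_iff[THEN iffD1]) auto
    moreover have "a\<^sup>2 \<le> (b + c)\<^sup>2" using assms by (intro power_mono) auto
    ultimately show ?thesis by (simp add: power2_eq_square algebra_simps abs_le_iff)
  qed
  then have "\<bar>x\<bar> \<le> b" using c by (simp add: x_def abs_divide divide_le_eq)
  then have x2: "x\<^sup>2 \<le> b\<^sup>2" using abs_le_square_iff[of x b] assms by simp
  define r where "r = Complex x (sqrt (b\<^sup>2 - x\<^sup>2))"
  have rb: "dist r 0 = b" using x2 assms by (simp add: r_def dist_norm cmod_def)
  have "dist (of_real c) r = sqrt ((c - x)\<^sup>2 + (b\<^sup>2 - x\<^sup>2))"
    using x2 by (simp add: r_def dist_norm cmod_def)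
  also have "(c - x)\<^sup>2 + (b\<^sup>2 - x\<^sup>2) = a\<^sup>2"
    using c by (simp add: x_def field_simps power2_eq_square)
  finally have "dist (of_real c) r = a" using assms by simp
  then show ?thesis using rb c by (intro that[of 0 "of_real c" r]) (auto simp: dist_norm)
qed

text \<open>Stewart's theorem, which evaluates the comparison distance in \<open>CN\<close>.\<close>

lemma norm_convex_combination_sq:
  fixes x y :: "'a::real_inner"
  shows "(norm ((1 - t) *\<^sub>R x + t *\<^sub>R y))\<^sup>2 = (1 - t) * (norm x)\<^sup>2 + t * (norm y)\<^sup>2 - t * (1 - t) * (norm (x - y))\<^sup>2"
  by (simp add: power2_norm_eq_inner inner_add_left inner_add_right inner_diff_left inner_diff_right
      inner_commute[of y x] algebra_simps)

text \<open>\<open>G a b\<close> is a chosen geodesic, rescaled to the unit interval.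
  \<open>CN\<close> is the Bruhat-Tits inequality; uniqueness and continuity of geodesics and the
  existence of centres all come from it, without a return to comparison triangles.\<close>

locale CAT0_geodesics = Metric_space M d for M :: "'x set" and d +
  fixes G :: "'x \<Rightarrow> 'x \<Rightarrow> real \<Rightarrow> 'x"
  assumes G_in: "\<And>a b t. a \<in> M \<Longrightarrow> b \<in> M \<Longrightarrow> t \<in> {0..1} \<Longrightarrow> G a b t \<in> M"
    and G_left: "\<And>a b t. a \<in> M \<Longrightarrow> b \<in> M \<Longrightarrow> t \<in> {0..1} \<Longrightarrow> d a (G a b t) = t * d a b"
    and G_right: "\<And>a b t. a \<in> M \<Longrightarrow> b \<in> M \<Longrightarrow> t \<in> {0..1} \<Longrightarrow> d (G a b t) b = (1 - t) * d a b"
    and CN: "\<And>a b p t. a \<in> M \<Longrightarrow> b \<in> M \<Longrightarrow> p \<in> M \<Longrightarrow> t \<in> {0..1} \<Longrightarrow>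
      (d p (G a b t))\<^sup>2 \<le> (1 - t) * (d p a)\<^sup>2 + t * (d p b)\<^sup>2 - t * (1 - t) * (d a b)\<^sup>2"

lemma CAT0_space_geodesics:
  assumes "CAT0_space M d"
  obtains G where "CAT0_geodesics M d G"
proof -
  interpret Metric_space M d using assms by (simp add: CAT0_space_def)
  note cat = assms[unfolded CAT0_space_def, THEN conjunct2, THEN conjunct2]
  have "\<exists>\<gamma>. geodesic_path M d \<gamma> a b" if "a \<in> M" "b \<in> M" for a b
    using assms that by (auto simp: CAT0_space_def geodesic_space_def)
  then obtain \<gamma> where \<gamma>: "\<And>a b. a \<in> M \<Longrightarrow> b \<in> M \<Longrightarrow> geodesic_path M d (\<gamma> a b) a b"
    by metis
  define G where "G a b t = \<gamma> a b (t * d a b)" for a b t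
  have rng: "t * d a b \<in> {0..d a b}" if "t \<in> {0..1}" for t a b
    using that by (auto simp: mult_left_le_one_le)
  have isom: "d (\<gamma> a b s) (\<gamma> a b t) = \<bar>s - t\<bar>"
    if "a \<in> M" "b \<in> M" "s \<in> {0..d a b}" "t \<in> {0..d a b}" for a b s t
    using \<gamma>[OF that(1,2)] that(3,4) by (simp add: geodesic_path_def)
  have ends: "\<gamma> a b 0 = a" "\<gamma> a b (d a b) = b" "\<gamma> a b ` {0..d a b} \<subseteq> M" if "a \<in> M" "b \<in> M" for a b
    using \<gamma>[OF that] by (auto simp: geodesic_path_def)
  have "CAT0_geodesics M d G"
  proof
    fix a b t assume a: "a \<in> M" and b: "b \<in> M" and t: "t \<in> {0..1::real}"
    show "G a b t \<in> M" using ends(3)[OF a b] rng[OF t, of a b] unfolding G_def by blast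
    show "d a (G a b t) = t * d a b"
      using isom[OF a b, of 0 "t * d a b"] rng[OF t, of a b] ends[OF a b] t by (simp add: G_def)
    have "d (G a b t) b = \<bar>t * d a b - d a b\<bar>"
      using isom[OF a b, of "t * d a b" "d a b"] rng[OF t, of a b] ends[OF a b] t by (simp add: G_def)
    also have "\<dots> = (1 - t) * d a b" using rng[OF t, of a b] by (simp add: algebra_simps)
    finally show "d (G a b t) b = (1 - t) * d a b" .
    fix p assume p: "p \<in> M"
    obtain a' b' p' :: complex where tri: "dist a' b' = d a b" "dist b' p' = d b p" "dist p' a' = d p a"
    proof (rule complex_triangle_exists[of "d b p" "d p a" "d a b"])
      show "d b p \<le> d p a + d a b" using triangle[OF p a b] commute by simp
      show "d p a \<le> d b p + d a b" using triangle[OF p b a] commute by simp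
      show "d a b \<le> d b p + d p a" using triangle[OF a p b] commute by simp
    qed auto
    define m' where "m' = comparison_point a' b' (d a b) (t * d a b)"
    have "(G a b t, m') \<in> side_pairs (\<gamma> a b) (d a b) a' b'"
      using rng[OF t, of a b] by (auto simp: side_pairs_def G_def m'_def)
    \<comment> \<open>The vertex \<open>p\<close> is read as the end of the side from
      \<open>b\<close>. If \<open>d b p = 0\<close>, division by zero yields \<open>b'\<close>,
      which then equals \<open>p'\<close>.\<close>
    moreover have "(p, p') \<in> side_pairs (\<gamma> b p) (d b p) b' p'"
    proof -
      have "comparison_point b' p' (d b p) (d b p) = p'"
        using tri by (cases "d b p = 0") (auto simp: comparison_point_def)
      then show ?thesis using ends(2)[OF b p]
        unfolding side_pairs_def by (intro CollectI exI[of _ "d b p"]) auto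
    qed
    ultimately have le: "d p (G a b t) \<le> dist p' m'"
      using cat[THEN bspec, OF a, THEN bspec, OF b, THEN bspec, OF p, THEN spec, THEN spec, THEN spec,
          THEN spec, THEN spec, THEN spec, THEN mp, OF conjI, OF \<gamma>[OF a b] conjI, OF \<gamma>[OF b p] conjI,
          OF \<gamma>[OF p a] conjI, OF tri(1) conjI, OF tri(2,3), unfolded Let_def,
          THEN bspec, of "(p, p')", unfolded prod.case, THEN bspec, of "(G a b t, m')"]
      by simp
    have "m' - p' = (1 - t) *\<^sub>R (a' - p') + t *\<^sub>R (b' - p')"
    proof (cases "d a b = 0")
      case True
      then show ?thesis using tri by (simp add: m'_def comparison_point_def scaleR_conv_of_real algebra_simps)
    next
      case False
      then show ?thesis by (simp add: m'_def comparison_point_def scaleR_conv_of_real algebra_simps)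
    qed
    then have "(dist p' m')\<^sup>2 = (1 - t) * (d p a)\<^sup>2 + t * (d b p)\<^sup>2 - t * (1 - t) * (d a b)\<^sup>2"
      using norm_convex_combination_sq[of t "a' - p'" "b' - p'"] tri
      by (simp add: dist_norm norm_minus_commute)
    moreover have "(d p (G a b t))\<^sup>2 \<le> (dist p' m')\<^sup>2" using le by (intro power_mono) auto
    ultimately show "(d p (G a b t))\<^sup>2 \<le> (1 - t) * (d p a)\<^sup>2 + t * (d p b)\<^sup>2 - t * (1 - t) * (d a b)\<^sup>2"
      by (simp add: commute[of b p])
  qed
  then show ?thesis by (rule that)
qed

section \<open>Convex sets, isometries and centres\<close>

context CAT0_geodesics
begin

lemma G_0: "a \<in> M \<Longrightarrow> b \<in> M \<Longrightarrow> G a b 0 = a"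
  using G_left[of a b 0] G_in[of a b 0] zero[of a "G a b 0"] by simp

lemma G_1: "a \<in> M \<Longrightarrow> b \<in> M \<Longrightarrow> G a b 1 = b"
  using G_right[of a b 1] G_in[of a b 1] zero[of "G a b 1" b] by simp

text \<open>For such a \<open>p\<close> the right-hand side of \<open>CN\<close> vanishes.\<close>

lemma G_unique:
  assumes "a \<in> M" "b \<in> M" "p \<in> M" "t \<in> {0..1}" "d p a = t * d a b" "d p b = (1 - t) * d a b"
  shows "p = G a b t"
proof -
  have "(d p (G a b t))\<^sup>2 \<le> 0"
    using CN[of a b p t] assms by (simp add: power2_eq_square algebra_simps)
  then show ?thesis using zero[of p "G a b t"] G_in assms by simp
qed

definition geod_convex :: "'x set \<Rightarrow> bool" where
  "geod_convex C \<longleftrightarrow> C \<subseteq> M \<and> (\<forall>a\<in>C. \<forall>b\<in>C. \<forall>t\<in>{0..1}. G a b t \<in> C)"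

definition isometry :: "('x \<Rightarrow> 'x) \<Rightarrow> bool" where
  "isometry f \<longleftrightarrow> f ` M \<subseteq> M \<and> (\<forall>x\<in>M. \<forall>y\<in>M. d (f x) (f y) = d x y)"

lemma isometry_in: "isometry f \<Longrightarrow> x \<in> M \<Longrightarrow> f x \<in> M"
  and isometry_dist: "isometry f \<Longrightarrow> x \<in> M \<Longrightarrow> y \<in> M \<Longrightarrow> d (f x) (f y) = d x y"
  by (auto simp: isometry_def)

lemma isometry_G:
  assumes "isometry f" "a \<in> M" "b \<in> M" "t \<in> {0..1}"
  shows "f (G a b t) = G (f a) (f b) t"
  using assms isometry_dist[OF assms(1)] G_left[of a b t] G_right[of a b t] G_in[of a b t]
  by (intro G_unique) (auto simp: isometry_in commute[of "f (G a b t)" "f a"])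

lemma geod_convex_M: "geod_convex M"
  by (auto simp: geod_convex_def G_in)

lemma geod_convex_fixed: "isometry f \<Longrightarrow> geod_convex {x \<in> M. f x = x}"
  by (auto simp: geod_convex_def G_in isometry_G)

lemma closedin_fixed:
  assumes f: "isometry f"
  shows "closedin mtopology {x \<in> M. f x = x}"
proof (rule closedin_metric[THEN iffD2], intro conjI allI impI)
  fix x assume x: "x \<in> M - {x \<in> M. f x = x}"
  then have fx: "f x \<in> M" "f x \<noteq> x" "x \<in> M" using isometry_in[OF f] by auto
  have "False" if y: "y \<in> M" "f y = y" "d x y < d x (f x) / 2" for y
  proof -
    have "d x (f x) \<le> d x y + d (f y) (f x)" using triangle[OF fx(3) y(1) fx(1)] y by simp
    also have "\<dots> = d x y + d x y" using isometry_dist[OF f y(1) fx(3)] by (simp add: commute)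
    finally show False using y by simp
  qed
  then have "disjnt {x \<in> M. f x = x} (mball x (d x (f x) / 2))"
    by (auto simp: disjnt_iff)
  moreover have "d x (f x) / 2 > 0" using fx mdist_pos_eq by (metis half_gt_zero)
  ultimately show "\<exists>r>0. disjnt {x \<in> M. f x = x} (mball x r)" by blast
qed auto

lemma geod_convex_INT: "I \<noteq> {} \<Longrightarrow> (\<And>i. i \<in> I \<Longrightarrow> geod_convex (C i)) \<Longrightarrow> geod_convex (\<Inter>i\<in>I. C i)"
  by (fastforce simp: geod_convex_def)

text \<open>The centre minimises the sum of squared distances to \<open>A\<close> over
  \<open>C\<close>. By \<open>CN\<close> at midpoints this function is uniformly convex, so
  minimising sequences are Cauchy and the minimiser is unique, hence fixed by every symmetry of
  \<open>A\<close> and \<open>C\<close>. A finite orbit as \<open>A\<close> gives the Bruhat-Tits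
  theorem; a single point gives its projection to \<open>C\<close>.\<close>

lemma center_exists:
  assumes compl: "mcomplete" and C: "geod_convex C" "closedin mtopology C" "C \<noteq> {}"
    and A: "finite A" "A \<noteq> {}" "A \<subseteq> M"
  obtains z where "z \<in> C"
    "\<And>f. isometry f \<Longrightarrow> f ` A = A \<Longrightarrow> f ` C \<subseteq> C \<Longrightarrow> f z = z"
proof -
  define h where "h z = (\<Sum>a\<in>A. (d a z)\<^sup>2)" for z
  define k where "k = real (card A)"
  have k: "k \<ge> 1" using A by (simp add: k_def Suc_le_eq card_gt_0_iff)
  have CM: "C \<subseteq> M" using C by (simp add: geod_convex_def)
  define J where "J = Inf (h ` C)"
  have bdd: "bdd_below (h ` C)" unfolding h_def by (rule bdd_belowI2[of _ 0]) (simp add: sum_nonneg)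
  have J: "J \<le> h z" if "z \<in> C" for z unfolding J_def using bdd that by (rule cINF_lower)
  \<comment> \<open>Obtained by comparing \<open>J\<close> with the value of \<open>h\<close> at the
    midpoint; it yields both the Cauchy property and uniqueness.\<close>
  have mid: "k * (d x y)\<^sup>2 \<le> 2 * (h x - J) + 2 * (h y - J)" if x: "x \<in> C" and y: "y \<in> C" for x y
  proof -
    have m: "G x y (1/2) \<in> C" using C(1) x y by (auto simp: geod_convex_def)
    have "h (G x y (1/2)) \<le> (\<Sum>a\<in>A. (1/2) * (d a x)\<^sup>2 + (1/2) * (d a y)\<^sup>2 - (1/4) * (d x y)\<^sup>2)"
      unfolding h_def
    proof (rule sum_mono)
      fix a assume "a \<in> A"
      then show "(d a (G x y (1/2)))\<^sup>2 \<le> (1/2) * (d a x)\<^sup>2 + (1/2) * (d a y)\<^sup>2 - (1/4) * (d x y)\<^sup>2"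
        using CN[of x y a "1/2"] x y CM A by (auto simp: subset_iff)
    qed
    also have "\<dots> = (h x + h y) / 2 - k / 4 * (d x y)\<^sup>2"
      by (simp add: sum_subtractf sum.distrib h_def k_def sum_divide_distrib add_divide_distrib)
    finally show ?thesis using J[OF m] by (simp add: algebra_simps)
  qed
  have "\<exists>z\<in>C. h z < J + 1 / real (Suc n)" for n
    using cInf_lessD[of "h ` C" "J + 1 / real (Suc n)"] C(3) unfolding J_def by auto
  then obtain z where z: "\<And>n. z n \<in> C" "\<And>n. h (z n) < J + 1 / real (Suc n)" by metis
  have zd: "(d (z m) (z n))\<^sup>2 \<le> 2 / real (Suc m) + 2 / real (Suc n)" for m n
  proof -
    have "(d (z m) (z n))\<^sup>2 \<le> k * (d (z m) (z n))\<^sup>2" using k by (simp add: mult_le_cancel_right1)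
    also have "\<dots> \<le> 2 / real (Suc m) + 2 / real (Suc n)"
      using mid[OF z(1) z(1), of m n] z(2)[of m] z(2)[of n] by simp
    finally show ?thesis .
  qed
  have "MCauchy z"
    unfolding MCauchy_def
  proof (intro conjI allI impI)
    show "range z \<subseteq> M" using z CM by auto
    fix e :: real assume e: "e > 0"
    obtain N where N: "inverse (real (Suc N)) < e\<^sup>2 / 4" using reals_Archimedean[of "e\<^sup>2 / 4"] e by auto
    have "d (z m) (z n) < e" if mn: "m \<ge> N" "n \<ge> N" for m n
    proof -
      have "2 / real (Suc i) \<le> 2 * inverse (real (Suc N))" if "i \<ge> N" for i
        using that by (simp add: field_simps)
      from this[OF mn(1)] this[OF mn(2)] have "(d (z m) (z n))\<^sup>2 < e\<^sup>2" using zd[of m n] N by linarith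
      then show ?thesis using e by (simp add: power2_less_imp_less)
    qed
    then show "\<exists>N. \<forall>n n'. N \<le> n \<longrightarrow> N \<le> n' \<longrightarrow> d (z n) (z n') < e" by blast
  qed
  then obtain w where w: "limitin mtopology z w sequentially" using compl by (auto simp: mcomplete_def)
  have wC: "w \<in> C"
    using C(2) w z(1) unfolding metric_closedin_iff_sequentially_closed by blast
  have d0: "(\<lambda>n. d (z n) w) \<longlonglongrightarrow> 0"
    using w by (simp add: limitin_metric_dist_null)
  have "h w \<le> J"
  proof (rule LIMSEQ_le)
    show "(\<lambda>n. J + 1 / real (Suc n)) \<longlonglongrightarrow> J"
      using tendsto_add[OF tendsto_const lim_inverse_n' [THEN LIMSEQ_Suc], of J] by simp
    have "(\<lambda>n. d a (z n)) \<longlonglongrightarrow> d a w" if "a \<in> A" for a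
    proof -
      have "(\<lambda>n. d a (z n) - d a w) \<longlonglongrightarrow> 0"
      proof (rule Lim_null_comparison[OF _ d0], intro always_eventually allI)
        fix n
        have aM: "a \<in> M" "z n \<in> M" "w \<in> M" using A that z(1) wC CM by auto
        show "norm (d a (z n) - d a w) \<le> d (z n) w"
          using triangle[OF aM(1,3,2)] triangle[OF aM] by (simp add: commute abs_le_iff)
      qed
      then show ?thesis by (rule LIM_zero_cancel)
    qed
    then show "(\<lambda>n. h (z n)) \<longlonglongrightarrow> h w" unfolding h_def
      by (intro tendsto_sum tendsto_power)
    show "\<exists>N. \<forall>n\<ge>N. h (z n) \<le> J + 1 / real (Suc n)" using z(2) less_imp_le by blast
  qed
  have "f w = w" if f: "isometry f" "f ` A = A" "f ` C \<subseteq> C" for f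
  proof -
    have fw: "f w \<in> C" using f wC by auto
    have inj: "inj_on f A" 
    proof (rule inj_onI)
      fix a b assume ab: "a \<in> A" "b \<in> A" "f a = f b"
      then have M: "a \<in> M" "b \<in> M" using A(3) by auto
      have "d a b = d (f a) (f b)" using isometry_dist[OF f(1) M] by simp
      also have "\<dots> = 0" using ab(3) isometry_in[OF f(1) M(2)] by simp
      finally show "a = b" using zero[OF M] by simp
    qed
    have "h (f w) = (\<Sum>a\<in>f ` A. (d a (f w))\<^sup>2)" by (simp add: h_def f(2))
    also have "\<dots> = (\<Sum>a\<in>A. (d (f a) (f w))\<^sup>2)" using inj by (simp add: sum.reindex)
    also have "\<dots> = h w" unfolding h_def
      by (rule sum.cong) (use isometry_dist[OF f(1)] A(3) wC CM in auto)
    finally have "k * (d (f w) w)\<^sup>2 \<le> 0" using mid[OF fw wC] \<open>h w \<le> J\<close> by simp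
    then have "(d (f w) w)\<^sup>2 \<le> 0" using k by (simp add: mult_le_0_iff)
    then show ?thesis using zero[of "f w" w] fw wC CM by auto
  qed
  then show ?thesis using that wC by blast
qed

text \<open>\<open>T\<close> preserves the common fixed set of \<open>S\<close> and fixes
  \<open>y\<close>, so it fixes the projection of \<open>y\<close> to that set.\<close>

lemma fixed_sets_commuting:
  assumes compl: "mcomplete"
    and S: "\<And>f. f \<in> S \<Longrightarrow> isometry f" and T: "\<And>g. g \<in> T \<Longrightarrow> isometry g"
    and comm: "\<And>f g x. f \<in> S \<Longrightarrow> g \<in> T \<Longrightarrow> x \<in> M \<Longrightarrow> f (g x) = g (f x)"
    and x: "x \<in> M" "\<And>f. f \<in> S \<Longrightarrow> f x = x"
    and y: "y \<in> M" "\<And>g. g \<in> T \<Longrightarrow> g y = y"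
  obtains z where "z \<in> M" "\<And>f. f \<in> S \<union> T \<Longrightarrow> f z = z"
proof (cases "S = {}")
  case True
  then show ?thesis using that[of y] y by auto
next
  case False
  define C where "C = (\<Inter>f\<in>S. {x \<in> M. f x = x})"
  have C: "geod_convex C" "closedin mtopology C" "C \<noteq> {}"
    unfolding C_def using False S x
    by (auto intro!: geod_convex_INT geod_convex_fixed closedin_fixed)
  obtain z where z: "z \<in> C"
    "\<And>f. isometry f \<Longrightarrow> f ` {y} = {y} \<Longrightarrow> f ` C \<subseteq> C \<Longrightarrow> f z = z"
    using center_exists[OF compl C, of "{y}"] y by auto
  have "g z = z" if g: "g \<in> T" for g
  proof (rule z(2))
    show "g ` C \<subseteq> C"
    proof
      fix u assume "u \<in> g ` C"
      then obtain v where v: "v \<in> C" "u = g v" by blast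
      then have vM: "v \<in> M" and fv: "\<And>f. f \<in> S \<Longrightarrow> f v = v" using False by (auto simp: C_def)
      have "u \<in> M" "f u = u" if "f \<in> S" for f
        using v(2) comm[OF that g vM] isometry_in[OF T[OF g] vM] fv[OF that] by auto
      then show "u \<in> C" using False by (auto simp: C_def)
    qed
  qed (use g y T in auto)
  then show ?thesis using that[of z] z(1) False by (auto simp: C_def)
qed

end

subsection \<open>Helly's theorem for products of simplices\<close>

lemma continuous_on_Max_insert:
  fixes f :: "'i \<Rightarrow> 'a::topological_space \<Rightarrow> real"
  assumes "finite A" "\<And>i. i \<in> A \<Longrightarrow> continuous_on S (f i)"
  shows "continuous_on S (\<lambda>t. Max (insert 0 ((\<lambda>i. f i t) ` A)))"
  using assms
proof (induction A)
  case (insert i A)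
  have eq: "(\<lambda>t. Max (insert 0 ((\<lambda>i. f i t) ` insert i A))) = (\<lambda>t. max (f i t) (Max (insert 0 ((\<lambda>i. f i t) ` A))))"
    using insert.hyps by (simp add: insert_commute[of 0])
  show ?case unfolding eq using insert by (intro continuous_on_max) auto
qed simp

lemma continuous_on_Min:
  fixes f :: "'i \<Rightarrow> 'a::topological_space \<Rightarrow> real"
  assumes "finite A" "A \<noteq> {}" "\<And>i. i \<in> A \<Longrightarrow> continuous_on S (f i)"
  shows "continuous_on S (\<lambda>t. Min ((\<lambda>i. f i t) ` A))"
  using assms
proof (induction A rule: finite_ne_induct)
  case (insert i A)
  then show ?case by (auto intro!: continuous_on_min)
qed simp

lemma open_set_separator:
  fixes S :: "'a::metric_space set"
  assumes "open S"
  obtains \<phi> :: "'a \<Rightarrow> real" where "continuous_on UNIV \<phi>" "\<And>t. 0 \<le> \<phi> t" "\<And>t. 0 < \<phi> t \<longleftrightarrow> t \<in> S"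
proof (cases "S = UNIV")
  case True
  \<comment> \<open>\<open>infdist\<close> to the empty complement is 0 by convention, hence the
    separate case.\<close>
  then show ?thesis by (intro that[of "\<lambda>_. 1"]) auto
next
  case False
  have "0 < infdist t (- S) \<longleftrightarrow> t \<in> S" for t
  proof -
    have "- S \<noteq> {}" using False by blast
    then show ?thesis
      using in_closed_iff_infdist_zero[of "- S" t] assms infdist_nonneg[of t "- S"]
      by (auto simp: closed_Compl less_le)
  qed
  then show ?thesis
    by (intro that[of "\<lambda>t. infdist t (- S)"]) (auto intro!: continuous_intros infdist_nonneg)
qed

text \<open>Makes the cones below defined and continuous for all real parameters, as
  \<open>poincare_miranda\<close> wants functions continuous on the whole space.\<close>

definition clamp01 :: "real \<Rightarrow> real" where "clamp01 x = max 0 (min 1 x)"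

lemma clamp01_in: "clamp01 x \<in> {0..1}"
  and clamp01_0 [simp]: "clamp01 0 = 0" and clamp01_1 [simp]: "clamp01 1 = 1"
  by (auto simp: clamp01_def)

section \<open>Continuous filling of simplices by geodesics\<close>

context CAT0_geodesics
begin

text \<open>Phrased by distances because the target is a carrier set with a metric, not a type with
  a topology.\<close>

definition mcont :: "('t::topological_space \<Rightarrow> 'x) \<Rightarrow> bool" where
  "mcont f \<longleftrightarrow> range f \<subseteq> M \<and> (\<forall>t. ((\<lambda>u. d (f u) (f t)) \<longlongrightarrow> 0) (at t))"

lemma mcont_dist:
  assumes f: "mcont f" and g: "mcont g"
  shows "((\<lambda>u. d (f u) (g u)) \<longlongrightarrow> d (f t) (g t)) (at t)"
proof -
  have lim: "((\<lambda>u. d (f u) (f t) + d (g u) (g t)) \<longlongrightarrow> 0) (at t)"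
    using tendsto_add[of "\<lambda>u. d (f u) (f t)" 0 "at t" "\<lambda>u. d (g u) (g t)" 0] f g
    by (simp add: mcont_def)
  have M: "f u \<in> M" "g u \<in> M" for u using f g by (auto simp: mcont_def)
  have "norm (d (f u) (g u) - d (f t) (g t)) \<le> d (f u) (f t) + d (g u) (g t)" for u
  proof -
    have "d (f u) (g u) \<le> d (f u) (f t) + d (f t) (g t) + d (g t) (g u)"
      using triangle[OF M(1)[of u] M(1)[of t] M(2)[of u]] triangle[OF M(1)[of t] M(2)[of t] M(2)[of u]] by simp
    moreover have "d (f t) (g t) \<le> d (f t) (f u) + d (f u) (g u) + d (g u) (g t)"
      using triangle[OF M(1)[of t] M(1)[of u] M(2)[of t]] triangle[OF M(1)[of u] M(2)[of u] M(2)[of t]] by simp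
    ultimately show ?thesis by (simp add: commute[of "g t"] commute[of "f t" "f u"])
  qed
  then have "((\<lambda>u. d (f u) (g u) - d (f t) (g t)) \<longlongrightarrow> 0) (at t)"
    by (intro Lim_null_comparison[OF _ lim] always_eventually allI)
  then show ?thesis by (rule LIM_zero_cancel)
qed

text \<open>\<open>CN\<close> is applied on the segment at \<open>t\<close>, with the moving point
  \<open>z u\<close> as the outer point. The triangle inequality bounds its distances to the two
  ends, and in the limit the bound \<open>B\<close> becomes the case of equality in Stewart's
  theorem, which is 0.\<close>

lemma mcont_G:
  assumes f: "mcont f" and g: "mcont g" and \<tau>: "\<And>t. (\<tau> \<longlongrightarrow> \<tau> t) (at t)" "\<And>t. \<tau> t \<in> {0..1}"
  shows "mcont (\<lambda>u. G (f u) (g u) (\<tau> u))"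
  unfolding mcont_def
proof (intro conjI allI)
  have M: "f u \<in> M" "g u \<in> M" for u using f g by (auto simp: mcont_def)
  have GM: "G (f u) (g u) (\<tau> u) \<in> M" for u using M \<tau>(2) by (intro G_in) auto
  then show "range (\<lambda>u. G (f u) (g u) (\<tau> u)) \<subseteq> M" by auto
  fix t
  define s where "s = \<tau> t"
  define z where "z u = G (f u) (g u) (\<tau> u)" for u
  define B where "B u = (1 - s) * (\<tau> u * d (f u) (g u) + d (f u) (f t))\<^sup>2
     + s * ((1 - \<tau> u) * d (f u) (g u) + d (g u) (g t))\<^sup>2 - s * (1 - s) * (d (f t) (g t))\<^sup>2" for u
  have s: "s \<in> {0..1}" using \<tau>(2) by (simp add: s_def)
  have "(d (z u) (z t))\<^sup>2 \<le> B u" for u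
  proof -
    have zu: "z u \<in> M" using GM by (simp add: z_def)
    have "(d (z u) (z t))\<^sup>2 \<le> (1 - s) * (d (z u) (f t))\<^sup>2 + s * (d (z u) (g t))\<^sup>2 - s * (1 - s) * (d (f t) (g t))\<^sup>2"
      using CN[OF M(1)[of t] M(2)[of t] zu s] by (simp add: z_def s_def)
    moreover have "d (z u) (f t) \<le> \<tau> u * d (f u) (g u) + d (f u) (f t)"
      using triangle[OF zu M(1)[of u] M(1)[of t]] G_left[OF M(1)[of u] M(2)[of u] \<tau>(2)[of u]]
      by (simp add: z_def commute)
    moreover have "d (z u) (g t) \<le> (1 - \<tau> u) * d (f u) (g u) + d (g u) (g t)"
      using triangle[OF zu M(2)[of u] M(2)[of t]] G_right[OF M(1)[of u] M(2)[of u] \<tau>(2)[of u]]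
      by (simp add: z_def)
    ultimately show ?thesis
      using s unfolding B_def
      by (smt (verit) atLeastAtMost_iff mult_left_mono nonneg power_mono)
  qed
  moreover have "(B \<longlongrightarrow> 0) (at t)"
  proof -
    have "((\<lambda>u. d (f u) (f t)) \<longlongrightarrow> 0) (at t)" "((\<lambda>u. d (g u) (g t)) \<longlongrightarrow> 0) (at t)"
      using f g by (auto simp: mcont_def)
    then have "(B \<longlongrightarrow> (1 - s) * (\<tau> t * d (f t) (g t) + 0)\<^sup>2
      + s * ((1 - \<tau> t) * d (f t) (g t) + 0)\<^sup>2 - s * (1 - s) * (d (f t) (g t))\<^sup>2) (at t)"
      unfolding B_def by (intro tendsto_intros mcont_dist f g \<tau>(1))
    also have "(1 - s) * (\<tau> t * d (f t) (g t) + 0)\<^sup>2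
      + s * ((1 - \<tau> t) * d (f t) (g t) + 0)\<^sup>2 - s * (1 - s) * (d (f t) (g t))\<^sup>2 = 0"
      by (simp add: s_def power2_eq_square algebra_simps)
    finally show ?thesis .
  qed
  ultimately have "((\<lambda>u. (d (z u) (z t))\<^sup>2) \<longlongrightarrow> 0) (at t)"
    by (intro Lim_null_comparison[of "\<lambda>u. (d (z u) (z t))\<^sup>2" B]) auto
  from tendsto_real_sqrt[OF this] show "((\<lambda>u. d (G (f u) (g u) (\<tau> u)) (G (f t) (g t) (\<tau> t))) \<longlongrightarrow> 0) (at t)"
    by (simp add: z_def)
qed

lemma mcont_open_preimage:
  assumes f: "mcont f" and V: "openin mtopology V"
  shows "open {u. f u \<in> V}"
proof (subst open_subopen, intro ballI)
  fix t assume t: "t \<in> {u. f u \<in> V}"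
  then obtain r where r: "r > 0" "mball (f t) r \<subseteq> V" using V by (auto simp: openin_mtopology)
  have M: "f u \<in> M" for u using f by (auto simp: mcont_def)
  have "eventually (\<lambda>u. d (f u) (f t) < r) (at t)"
    using tendstoD[of _ 0 "at t" r] f r(1) by (fastforce simp: mcont_def)
  then obtain T where T: "open T" "t \<in> T" "\<And>u. u \<in> T \<Longrightarrow> u \<noteq> t \<Longrightarrow> d (f u) (f t) < r"
    by (auto simp: eventually_at_topological)
  have "T \<subseteq> {u. f u \<in> V}"
  proof
    fix u assume u: "u \<in> T"
    show "u \<in> {u. f u \<in> V}"
    proof (cases "u = t")
      case False
      then have "f u \<in> mball (f t) r" using T(3)[OF u] M by (simp add: commute)
      then show ?thesis using r by auto
    qed (use t in auto)
  qed
  then show "\<exists>T. open T \<and> t \<in> T \<and> T \<subseteq> {u. f u \<in> V}" using T by blast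
qed

text \<open>The parameters \<open>\<tau> 1, \<dots>, \<tau> k\<close> are cube coordinates on the simplex spanned by
\<open>p 0, \<dots>, p k\<close>: the barycentric coordinate of \<open>p s\<close> vanishes iff \<open>\<tau> s = 0\<close> (for \<open>s > 0\<close>)
or \<open>\<tau> s' = 1\<close> for some \<open>s' > s\<close>. The value \<open>\<tau> 0\<close> is ignored.\<close>

primrec gcone :: "(nat \<Rightarrow> 'x) \<Rightarrow> (nat \<Rightarrow> real) \<Rightarrow> nat \<Rightarrow> 'x" where
  "gcone p \<tau> 0 = p 0"
| "gcone p \<tau> (Suc s) = G (gcone p \<tau> s) (p (Suc s)) (clamp01 (\<tau> (Suc s)))"

lemma gcone_extend:
  assumes "geod_convex C" "gcone p \<tau> j \<in> C" "\<And>r. j < r \<Longrightarrow> r \<le> k \<Longrightarrow> p r \<in> C" "j \<le> k"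
  shows "gcone p \<tau> k \<in> C"
  using assms(4,3)
proof (induction k rule: dec_induct)
  case base
  then show ?case using assms(2) by simp
next
  case (step k)
  then show ?case using assms(1) clamp01_in by (simp add: geod_convex_def)
qed

lemma gcone_in:
  assumes "geod_convex C" "\<And>r. r \<le> k \<Longrightarrow> p r \<in> C"
  shows "gcone p \<tau> k \<in> C"
  using gcone_extend[of C p \<tau> 0 k] assms by simp

text \<open>If \<open>\<tau> s = 0\<close>, the step that would add \<open>p s\<close> does not move
  the point; if \<open>\<tau> s' = 1\<close> for a later \<open>s'\<close>, that step jumps to
  \<open>p s'\<close> and forgets all earlier vertices. Either way \<open>p s\<close> has no
  influence and convexity does the rest.\<close>

lemma gcone_face:
  assumes C: "geod_convex C" and M: "\<And>r. p r \<in> M"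
    and p: "\<And>r. r \<le> k \<Longrightarrow> r \<noteq> s \<Longrightarrow> p r \<in> C" and s: "s \<le> k"
    and face: "0 < s \<and> \<tau> s = 0 \<or> (\<exists>s'. s < s' \<and> s' \<le> k \<and> \<tau> s' = 1)"
  shows "gcone p \<tau> k \<in> C"
  using face
proof (elim disjE conjE exE)
  assume "0 < s" "\<tau> s = 0"
  then obtain j where j: "s = Suc j" by (cases s) auto
  have "gcone p \<tau> j \<in> C" using C p j s by (intro gcone_in) auto
  moreover have "gcone p \<tau> s = gcone p \<tau> j"
    using \<open>\<tau> s = 0\<close> j G_0 M gcone_in[OF geod_convex_M, of j p] by simp
  ultimately have "gcone p \<tau> s \<in> C" by simp
  from gcone_extend[OF C this _ s] show ?thesis using p by auto
next
  fix s' assume s': "s < s'" "s' \<le> k" "\<tau> s' = 1"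
  then obtain j where j: "s' = Suc j" by (cases s') auto
  have "gcone p \<tau> s' = p s'"
    using s' j G_1 M gcone_in[OF geod_convex_M, of j p] by simp
  then have "gcone p \<tau> s' \<in> C" using p s' by simp
  from gcone_extend[OF C this _ s'(2)] show ?thesis using p s' by auto
qed

lemma mcont_cone:
  assumes "\<And>r. mcont (\<lambda>t. p t r)" "\<And>r. continuous_on UNIV (\<lambda>t. \<tau> t r)"
  shows "mcont (\<lambda>t. gcone (p t) (\<tau> t) k)"
proof (induction k)
  case 0
  then show ?case using assms by simp
next
  case (Suc k)
  have "continuous_on UNIV (\<lambda>t. clamp01 (\<tau> t (Suc k)))"
    unfolding clamp01_def by (intro continuous_intros assms(2))
  then have "((\<lambda>t. clamp01 (\<tau> t (Suc k))) \<longlongrightarrow> clamp01 (\<tau> t (Suc k))) (at t)" for t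
    by (simp add: continuous_on_def)
  then show ?case using Suc assms(1) clamp01_in by (auto intro: mcont_G)
qed

text \<open>A product of simplices is filled by coning in one factor at a time: stage
  \<open>i\<close> overwrites coordinate \<open>i\<close> of \<open>v\<close>, and \<open>v\<close>
  keeps a choice of vertex in the factors still to come.\<close>

primrec multicone :: "nat \<Rightarrow> ((nat \<Rightarrow> nat) \<Rightarrow> 'x) \<Rightarrow> (nat \<times> nat \<Rightarrow> real) \<Rightarrow> nat \<Rightarrow> (nat \<Rightarrow> nat) \<Rightarrow> 'x" where
  "multicone k P t 0 v = P v"
| "multicone k P t (Suc i) v = gcone (\<lambda>s. multicone k P t i (v(i := s))) (\<lambda>s. t (i, s)) k"

lemma mcont_const: "x \<in> M \<Longrightarrow> mcont (\<lambda>_. x)"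
  by (auto simp: mcont_def)

lemma mcont_multicone:
  assumes "\<And>v. P v \<in> M"
  shows "mcont (\<lambda>t. multicone k P t j v)"
proof (induction j arbitrary: v)
  case (Suc j)
  show ?case unfolding multicone.simps
    by (rule mcont_cone[OF Suc.IH]) simp
qed (simp add: mcont_const assms)

text \<open>Before stage \<open>i\<close> all points with \<open>v i\<close> different from
  \<open>s\<close> lie in \<open>C\<close>; stage \<open>i\<close> is \<open>gcone_face\<close>;
  later stages cone inside the convex set \<open>C\<close>.\<close>

lemma multicone_face:
  assumes C: "geod_convex C" and M: "\<And>v. P v \<in> M"
    and P: "\<And>v. v i \<le> k \<Longrightarrow> v i \<noteq> s \<Longrightarrow> P v \<in> C" and s: "s \<le> k" and ij: "i < j"
    and face: "0 < s \<and> t (i, s) = 0 \<or> (\<exists>s'. s < s' \<and> s' \<le> k \<and> t (i, s') = 1)"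
  shows "multicone k P t j v \<in> C"
proof -
  have multM: "multicone k P t j v \<in> M" for j v
    using mcont_multicone[of P k j v, OF M] by (auto simp: mcont_def)
  have before: "multicone k P t j v \<in> C" if "j \<le> i" "v i \<le> k" "v i \<noteq> s" for j v
    using that
  proof (induction j arbitrary: v)
    case (Suc j)
    then show ?case by (auto intro!: gcone_in[OF C])
  qed (use P in auto)
  show ?thesis
    using Suc_leI[OF ij]
  proof (induction j arbitrary: v rule: dec_induct)
    case base
    show ?case unfolding multicone.simps
      by (rule gcone_face[OF C multM _ s face]) (auto intro: before)
  next
    case (step j)
    then show ?case by (auto intro!: gcone_in[OF C])
  qed
qed

text \<open>A KKM-type argument. \<open>hit\<close> supplies vertices for a map \<open>f\<close>
  from a product of \<open>l\<close> simplices whose faces land in the sets \<open>C i s\<close>,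
  and \<open>miss\<close> says that complements cover \<open>M\<close>. Every finite open refinement
  of the resulting cover then has \<open>l * k + 1\<close> members with a common point on the image
  of \<open>f\<close>.\<close>

theorem product_helly:
  assumes C: "\<And>i s. i < l \<Longrightarrow> s \<le> k \<Longrightarrow> geod_convex (C i s)"
    "\<And>i s. i < l \<Longrightarrow> s \<le> k \<Longrightarrow> closedin mtopology (C i s)"
    and miss: "\<And>i x. i < l \<Longrightarrow> x \<in> M \<Longrightarrow> \<exists>s\<le>k. x \<notin> C i s"
    and hit: "\<And>v. (\<And>i. i < l \<Longrightarrow> v i \<le> k) \<Longrightarrow> \<exists>x\<in>M. \<forall>i<l. \<forall>s\<le>k. s \<noteq> v i \<longrightarrow> x \<in> C i s"
    and dim: "covering_dim_le mtopology (int m)" and m: "m < l * k"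
  shows False
proof -
  \<comment> \<open>Truncation by \<open>min k\<close> makes \<open>hit\<close> apply to every
    \<open>v\<close>, so that \<open>P\<close> is total.\<close>
  have "\<exists>x\<in>M. \<forall>i<l. \<forall>s\<le>k. s \<noteq> min k (v i) \<longrightarrow> x \<in> C i s" for v
    by (rule hit) simp
  then obtain P where PM: "\<And>v. P v \<in> M"
    and PC: "\<And>v i s. i < l \<Longrightarrow> s \<le> k \<Longrightarrow> s \<noteq> min k (v i) \<Longrightarrow> P v \<in> C i s"
    by metis
  define f where "f t = multicone k P t l (\<lambda>_. 0)" for t
  have fc: "mcont f" unfolding f_def by (rule mcont_multicone[OF PM])
  have fM: "f t \<in> M" for t using fc by (auto simp: mcont_def)
  have face: "f t \<in> C i s" if "i < l" "s \<le> k"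
    "0 < s \<and> t (i, s) = 0 \<or> (\<exists>s'. s < s' \<and> s' \<le> k \<and> t (i, s') = 1)" for t i s
    unfolding f_def
    by (rule multicone_face[OF C(1)[OF that(1,2)] PM _ that(2,1,3)]) (use PC that in auto)

  define \<U> where "\<U> = (\<lambda>v. {x \<in> M. \<forall>i<l. x \<notin> C i (v i)}) ` (PiE {..<l} (\<lambda>_. {..k}))"
  have U1: "finite \<U>" unfolding \<U>_def by (intro finite_imageI finite_PiE) auto
  have U2: "openin mtopology U" if U: "U \<in> \<U>" for U
  proof -
    obtain v where v: "v \<in> PiE {..<l} (\<lambda>_. {..k})" "U = {x \<in> M. \<forall>i<l. x \<notin> C i (v i)}"
      using U unfolding \<U>_def by blast
    have "U = topspace mtopology - (\<Union>i\<in>{..<l}. C i (v i))" using v by auto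
    moreover have "closedin mtopology (\<Union>i\<in>{..<l}. C i (v i))"
      using v(1) C(2) by (intro closedin_Union) (auto simp: PiE_iff)
    ultimately show ?thesis by (simp add: openin_diff)
  qed
  have U3: "\<Union>\<U> = topspace mtopology"
  proof (intro equalityI subsetI)
    fix x assume "x \<in> topspace mtopology"
    then have x: "x \<in> M" by simp
    then have "\<forall>i\<in>{..<l}. \<exists>s\<le>k. x \<notin> C i s" using miss by simp
    then obtain v where v: "\<And>i. i < l \<Longrightarrow> v i \<le> k \<and> x \<notin> C i (v i)" by (metis lessThan_iff)
    have vl: "restrict v {..<l} \<in> PiE {..<l} (\<lambda>_. {..k})" using v by auto
    have xv: "x \<in> {x \<in> M. \<forall>i<l. x \<notin> C i (restrict v {..<l} i)}" using v x by auto
    show "x \<in> \<Union>\<U>" unfolding \<U>_def by (rule UN_I, rule vl, rule xv)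
  qed (auto simp: \<U>_def)
  obtain \<V> where "finite \<V> \<and> (\<forall>V\<in>\<V>. openin mtopology V) \<and> \<Union>\<V> = topspace mtopology \<and>
      (\<forall>V\<in>\<V>. \<exists>U\<in>\<U>. V \<subseteq> U) \<and> (\<forall>x\<in>topspace mtopology. int (card {V \<in> \<V>. x \<in> V}) \<le> int m + 1)"
    using dim[unfolded covering_dim_le_def, THEN spec, THEN mp, OF conjI[OF U1 conjI[OF ballI[OF U2] U3]]]
    by (rule exE)
  then have V1: "finite \<V>" and V2: "\<And>V. V \<in> \<V> \<Longrightarrow> openin mtopology V"
    and V3: "\<Union>\<V> = M" and V4: "\<And>V. V \<in> \<V> \<Longrightarrow> \<exists>U\<in>\<U>. V \<subseteq> U"
    and V5: "\<And>x. x \<in> M \<Longrightarrow> int (card {V \<in> \<V>. x \<in> V}) \<le> int m + 1"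
    by simp_all
  have "\<exists>v. \<forall>i<l. v i \<le> k \<and> (\<forall>x\<in>V. x \<notin> C i (v i))" if V: "V \<in> \<V>" for V
  proof -
    obtain v where "v \<in> PiE {..<l} (\<lambda>_. {..k})" "V \<subseteq> {x \<in> M. \<forall>i<l. x \<notin> C i (v i)}"
      using V4[OF V] unfolding \<U>_def by blast
    then show ?thesis by (intro exI[of _ v]) (auto simp: PiE_iff)
  qed
  then obtain J where J: "\<And>V i. V \<in> \<V> \<Longrightarrow> i < l \<Longrightarrow> J V i \<le> k"
    "\<And>V i x. V \<in> \<V> \<Longrightarrow> i < l \<Longrightarrow> x \<in> V \<Longrightarrow> x \<notin> C i (J V i)"
    by metis

  have "\<exists>\<phi>::(nat \<times> nat \<Rightarrow> real) \<Rightarrow> real. continuous_on UNIV \<phi> \<and> (\<forall>t. 0 \<le> \<phi> t) \<and> (\<forall>t. 0 < \<phi> t \<longleftrightarrow> f t \<in> V)"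
    if V: "V \<in> \<V>" for V
    by (rule open_set_separator[OF mcont_open_preimage[OF fc V2[OF V]]]) auto
  then obtain \<phi> :: "'x set \<Rightarrow> (nat \<times> nat \<Rightarrow> real) \<Rightarrow> real"
    where \<phi>c: "\<And>V. V \<in> \<V> \<Longrightarrow> continuous_on UNIV (\<phi> V)"
      and \<phi>0: "\<And>V t. V \<in> \<V> \<Longrightarrow> 0 \<le> \<phi> V t"
      and \<phi>V: "\<And>V t. V \<in> \<V> \<Longrightarrow> 0 < \<phi> V t \<longleftrightarrow> f t \<in> V"
    by metis

  \<comment> \<open>The largest value at \<open>t\<close> of a member assigned to index
    \<open>s\<close> in factor \<open>i\<close>. Such members avoid \<open>C i s\<close>, so
    \<open>a i s\<close> vanishes where \<open>f\<close> lies in \<open>C i s\<close>, in particular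
    on the face opposite to vertex \<open>s\<close>.\<close>
  define a where "a i s t = Max (insert 0 ((\<lambda>V. \<phi> V t) ` {V \<in> \<V>. J V i = s}))" for i s t
  have ac: "continuous_on UNIV (a i s)" for i s
    unfolding a_def using V1 \<phi>c by (intro continuous_on_Max_insert) auto
  have a0: "0 \<le> a i s t" for i s t unfolding a_def using V1 by (intro Max_ge) auto
  have a_ge: "\<phi> V t \<le> a i (J V i) t" if "V \<in> \<V>" for V i t
    unfolding a_def using V1 that by (intro Max_ge) auto
  have a_attained: "\<exists>V\<in>\<V>. \<phi> V t = a i s t" if "0 < a i s t" for i s t
  proof -
    have "a i s t \<in> insert 0 ((\<lambda>V. \<phi> V t) ` {V \<in> \<V>. J V i = s})"
      unfolding a_def using V1 by (intro Max_in) auto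
    then show ?thesis using that by auto
  qed
  have a_zero: "a i s t = 0" if "i < l" "f t \<in> C i s" for i s t
  proof (rule ccontr)
    assume "a i s t \<noteq> 0"
    then have pos: "0 < a i s t" using a0[of i s t] by simp
    have "a i s t \<in> insert 0 ((\<lambda>V. \<phi> V t) ` {V \<in> \<V>. J V i = s})"
      unfolding a_def using V1 by (intro Max_in) auto
    then obtain V where V: "V \<in> \<V>" "J V i = s" "0 < \<phi> V t" using pos by auto
    then show False using J(2)[OF V(1) that(1), of "f t"] \<phi>V that by simp
  qed

  text \<open>The weights make the levels \<open>a i s\<close> pairwise distinct at a common zero of the
    functions \<open>F\<close>, so these levels are attained at different members of the refinement.\<close>
  define \<kappa> where "\<kappa> i s = (if s = 0 then 1 else 2 + real (prod_encode (i, s)))" for i s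
  have \<kappa>1: "1 \<le> \<kappa> i s" for i s by (simp add: \<kappa>_def)
  define I where "I = {..<l} \<times> {1..k}"
  \<comment> \<open>For \<open>t (i, s) = 0\<close> the level of \<open>s\<close> vanishes; for
    \<open>t (i, s) = 1\<close> the level of index 0 does, and with it the minimum. A common zero
    makes each weighted level the minimum of its predecessors, so all weighted levels of a factor
    agree.\<close>
  define F where "F e t = \<kappa> (fst e) (snd e) * a (fst e) (snd e) t
    - Min ((\<lambda>s'. \<kappa> (fst e) s' * a (fst e) s' t) ` {..<snd e})" for e t
  obtain t where t: "\<And>e. e \<in> I \<Longrightarrow> F e t = 0"
  proof (rule poincare_miranda[of I F])
    show "finite I" by (simp add: I_def)
    fix e assume "e \<in> I"
    then obtain i s where e: "e = (i, s)" "i < l" "1 \<le> s" "s \<le> k" by (auto simp: I_def)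
    have "0 \<in> {..<s}" using e by simp
    then have ne: "{..<s} \<noteq> {}" by blast
    show "continuous_on UNIV (F e)"
      unfolding F_def using ne e
      by (intro continuous_intros continuous_on_Min ac) simp_all
    fix t :: "nat \<times> nat \<Rightarrow> real"
    have min0: "0 \<le> Min ((\<lambda>s'. \<kappa> i s' * a i s' t) ` {..<s})"
      using ne \<kappa>1[of i] a0 by (auto simp: order_trans[OF zero_le_one \<kappa>1])
    {
      assume "t e = 0"
      then have "a i s t = 0" using e face[of i s t] by (intro a_zero) auto
      then show "F e t \<le> 0" using min0 by (simp add: F_def e)
    next
      assume "t e = 1"
      then have "\<exists>s'>0. s' \<le> k \<and> t (i, s') = 1" using e by (intro exI[of _ s]) simp
      then have "a i 0 t = 0" using e face[of i 0 t] by (intro a_zero) auto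
      moreover have "Min ((\<lambda>s'. \<kappa> i s' * a i s' t) ` {..<s}) \<le> \<kappa> i 0 * a i 0 t"
        using \<open>0 \<in> {..<s}\<close> by (intro Min_le imageI) simp_all
      moreover have "0 \<le> \<kappa> i s * a i s t" using \<kappa>1[of i s] a0[of i s t] by simp
      ultimately show "0 \<le> F e t" by (simp add: F_def e)
    }
  qed blast
  have level: "\<kappa> i s * a i s t = a i 0 t" if "i < l" "s \<le> k" for i s
    using that(2)
  proof (induction s rule: less_induct)
    case (less s)
    show ?case
    proof (cases "s = 0")
      case False
      have "(\<lambda>s'. \<kappa> i s' * a i s' t) ` {..<s} = {a i 0 t}"
        using less False by force
      then show ?thesis using t[of "(i, s)"] that less.prems False by (simp add: F_def I_def)
    qed (simp add: \<kappa>_def)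
  qed
  obtain V0 where V0: "V0 \<in> \<V>" "f t \<in> V0" using V3 fM by blast
  define \<mu> where "\<mu> = Max ((\<lambda>V. \<phi> V t) ` \<V>)"
  have \<mu>_ge: "\<phi> V t \<le> \<mu>" if "V \<in> \<V>" for V unfolding \<mu>_def using V1 that by (intro Max_ge) auto
  have \<mu>0: "0 < \<mu>" using \<mu>_ge[OF V0(1)] \<phi>V[OF V0(1)] V0(2) by (meson less_le_trans)
  have "\<mu> \<in> (\<lambda>V. \<phi> V t) ` \<V>" unfolding \<mu>_def using V1 V0 by (intro Max_in) auto
  then obtain V' where V': "V' \<in> \<V>" "\<phi> V' t = \<mu>" by auto
  have a_le: "a i s t \<le> \<mu>" for i s
  proof (cases "0 < a i s t")
    case True
    then obtain V where "V \<in> \<V>" "\<phi> V t = a i s t" using a_attained by blast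
    then show ?thesis using \<mu>_ge[of V] by simp
  qed (use \<mu>0 in linarith)
  \<comment> \<open>A member of largest value counts in every factor for some index. As the weights
    are at least 1 and equal 1 at index 0, level 0 is the same \<open>\<mu>\<close> in all factors;
    this ties the factors together.\<close>
  have top: "a i 0 t = \<mu>" if "i < l" for i
  proof (rule antisym)
    have s: "J V' i \<le> k" using J(1) V' that by blast
    have "\<mu> \<le> a i (J V' i) t" using a_ge[OF V'(1), of t i] V'(2) by simp
    also have "\<dots> \<le> \<kappa> i (J V' i) * a i (J V' i) t"
      using \<kappa>1[of i "J V' i"] a0[of i "J V' i" t] by (simp add: mult_le_cancel_right1)
    also have "\<dots> = a i 0 t" by (rule level[OF that s])
    finally show "\<mu> \<le> a i 0 t" .
  qed (rule a_le)
  \<comment> \<open>For \<open>s \<ge> 1\<close> this is the level \<open>a i s t\<close>. The pair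
    \<open>(0, 0)\<close> stands for \<open>\<mu>\<close>, which all factors share, so the count is
    \<open>l * k + 1\<close> rather than \<open>l * (k + 1)\<close>.\<close>
  define L where "L e = \<mu> / \<kappa> (fst e) (snd e)" for e
  have inj: "inj_on L (insert (0, 0) I)"
  proof (rule inj_onI)
    fix e e' assume ee: "e \<in> insert (0, 0) I" "e' \<in> insert (0, 0) I" "L e = L e'"
    have "\<kappa> (fst e) (snd e) = \<kappa> (fst e') (snd e')"
      using ee(3) \<mu>0 \<kappa>1[of "fst e" "snd e"] \<kappa>1[of "fst e'" "snd e'"] by (simp add: L_def field_simps)
    then show "e = e'" using ee(1,2) by (auto simp: \<kappa>_def I_def split: if_splits)
  qed
  have sub: "L ` insert (0, 0) I \<subseteq> (\<lambda>V. \<phi> V t) ` {V \<in> \<V>. f t \<in> V}"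
  proof
    fix y assume "y \<in> L ` insert (0, 0) I"
    then obtain e where e: "e \<in> insert (0, 0) I" "y = L e" by blast
    have y0: "0 < y" using \<mu>0 \<kappa>1[of "fst e" "snd e"] e by (simp add: L_def)
    have "\<exists>V\<in>\<V>. \<phi> V t = y"
    proof (cases "e = (0, 0)")
      case True
      then have "y = \<mu>" using e(2) by (simp add: L_def \<kappa>_def)
      then show ?thesis using V' by blast
    next
      case False
      then obtain i s where ils: "e = (i, s)" "i < l" "s \<le> k" using e(1) by (auto simp: I_def)
      have "y = \<mu> / \<kappa> i s" using e(2) by (simp add: L_def ils(1))
      also have "\<dots> = a i s t"
        using level[OF ils(2,3)] top[OF ils(2)] \<kappa>1[of i s] by (simp add: field_simps)
      finally have "y = a i s t" .
      then show ?thesis using a_attained[of i s t] y0 by simp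
    qed
    then obtain V where "V \<in> \<V>" "\<phi> V t = y" by blast
    then show "y \<in> (\<lambda>V. \<phi> V t) ` {V \<in> \<V>. f t \<in> V}" using \<phi>V y0 by blast
  qed
  have fin: "finite I" "(0, 0) \<notin> I" and cI: "card I = l * k" by (auto simp: I_def)
  have "Suc (l * k) = card (insert (0, 0) I)" using fin cI by simp
  also have "\<dots> = card (L ` insert (0, 0) I)" using inj by (simp only: card_image)
  also have "\<dots> \<le> card ((\<lambda>V. \<phi> V t) ` {V \<in> \<V>. f t \<in> V})" using V1 by (intro card_mono[OF _ sub]) auto
  also have "\<dots> \<le> card {V \<in> \<V>. f t \<in> V}" using V1 by (intro card_image_le) auto
  also have "\<dots> \<le> m + 1" using V5[OF fM, of t] by simp
  finally show False using m by simp
qed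

end

subsection \<open>Automorphisms of universal Coxeter groups\<close>

lemma reduced_word_iff: "reduced_word n w \<longleftrightarrow> set w \<subseteq> {..<n} \<and> distinct_adj w"
  by (simp add: reduced_word_def distinct_adj_conv_nth)

lemma distinct_adj_push: "distinct_adj w \<Longrightarrow> distinct_adj (push_letter a w)"
  by (cases w) (auto simp: distinct_adj_Cons)

lemma set_push: "set (push_letter a w) \<subseteq> insert a (set w)"
  by (cases w) auto

lemma length_push: "length (push_letter a w) \<le> Suc (length w)"
  by (cases w) auto

text \<open>Van der Waerden's device: each letter acts on reduced words as an involution, and
  associativity of \<open>word_mult\<close> follows from this action.\<close>

lemma push_push: "distinct_adj w \<Longrightarrow> push_letter a (push_letter a w) = w"
  by (cases w; cases "tl w") auto

lemma push_Cons: "distinct_adj (a # w) \<Longrightarrow> push_letter a w = a # w"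
  by (cases w) auto

lemma word_mult_Nil [simp]: "word_mult [] v = v"
  and word_mult_Cons [simp]: "word_mult (a # u) v = push_letter a (word_mult u v)"
  and word_mult_append [simp]: "word_mult (u @ u') v = word_mult u (word_mult u' v)"
  by (simp_all add: word_mult_def)

lemma distinct_adj_mult [simp]: "distinct_adj v \<Longrightarrow> distinct_adj (word_mult u v)"
  by (induction u) (auto intro: distinct_adj_push)

lemma set_mult: "set (word_mult u v) \<subseteq> set u \<union> set v"
proof (induction u)
  case (Cons a u)
  then show ?case using set_push[of a "word_mult u v"] by auto
qed simp

lemma length_mult: "length (word_mult u v) \<le> length u + length v"
proof (induction u)
  case (Cons a u)
  then show ?case using length_push[of a "word_mult u v"] by simp
qed simp

lemma mult_push: "distinct_adj v \<Longrightarrow> word_mult (push_letter a u) v = push_letter a (word_mult u v)"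
  by (cases u) (auto simp: push_push)

lemma mult_assoc_word:
  "distinct_adj w \<Longrightarrow> word_mult (word_mult u v) w = word_mult u (word_mult v w)"
  by (induction u) (auto simp: mult_push)

lemma mult_append: "distinct_adj (u @ v) \<Longrightarrow> word_mult u v = u @ v"
proof (induction u)
  case (Cons a u)
  then have "word_mult u v = u @ v" by (cases "u @ v") (auto simp: distinct_adj_Cons)
  then show ?case using Cons.prems push_Cons by simp
qed simp

lemma mult_Nil_right: "distinct_adj u \<Longrightarrow> word_mult u [] = u"
  using mult_append[of u "[]"] by simp

lemma mult_rev_cancel: "distinct_adj w \<Longrightarrow> word_mult (rev u) (word_mult u w) = w"
  by (induction u) (auto simp: push_push)

lemma mult_cancel_rev: "distinct_adj w \<Longrightarrow> word_mult u (word_mult (rev u) w) = w"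
  using mult_rev_cancel[of w "rev u"] by simp

lemma carrier_UCox: "w \<in> carrier (UCox n) \<longleftrightarrow> set w \<subseteq> {..<n} \<and> distinct_adj w"
  by (simp add: UCox_def reduced_word_iff)

lemma mult_UCox [simp]: "u \<otimes>\<^bsub>UCox n\<^esub> v = word_mult u v"
  and one_UCox [simp]: "\<one>\<^bsub>UCox n\<^esub> = []"
  by (simp_all add: UCox_def)

lemma letter_in_UCox [simp]: "[i] \<in> carrier (UCox n) \<longleftrightarrow> i < n"
  and Nil_in_UCox [simp]: "[] \<in> carrier (UCox n)"
  by (auto simp: carrier_UCox)

lemma mult_in_UCox: "u \<in> carrier (UCox n) \<Longrightarrow> v \<in> carrier (UCox n) \<Longrightarrow> word_mult u v \<in> carrier (UCox n)"
  using set_mult[of u v] by (auto simp: carrier_UCox)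

lemma group_UCox: "group (UCox n)"
proof (rule groupI)
  fix x assume x: "x \<in> carrier (UCox n)"
  then have "rev x \<in> carrier (UCox n)" "word_mult (rev x) x = []"
    using mult_rev_cancel[of "[]" x] by (auto simp: carrier_UCox mult_Nil_right)
  then show "\<exists>y\<in>carrier (UCox n). y \<otimes>\<^bsub>UCox n\<^esub> x = \<one>\<^bsub>UCox n\<^esub>"
    by auto
qed (auto simp: mult_in_UCox, auto simp: mult_assoc_word carrier_UCox)

lemma hom_UCox_Nil: "\<alpha> \<in> hom (UCox n) (UCox n) \<Longrightarrow> \<alpha> [] = []"
  using hom_one[OF _ group_UCox group_UCox, of \<alpha>] by simp

lemma hom_UCox_Cons:
  assumes "\<alpha> \<in> hom (UCox n) (UCox n)" "a # w \<in> carrier (UCox n)"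
  shows "\<alpha> (a # w) = word_mult (\<alpha> [a]) (\<alpha> w)"
proof -
  have w: "[a] \<in> carrier (UCox n)" "w \<in> carrier (UCox n)"
    using assms(2) by (auto simp: carrier_UCox distinct_adj_Cons)
  have "word_mult [a] w = a # w"
    using assms(2) push_Cons by (simp add: carrier_UCox)
  then show ?thesis using hom_mult[OF assms(1) w] by simp
qed

lemma hom_UCox_eqI:
  assumes "\<alpha> \<in> hom (UCox n) (UCox n)" "\<beta> \<in> hom (UCox n) (UCox n)"
    and "\<alpha> \<in> extensional (carrier (UCox n))" "\<beta> \<in> extensional (carrier (UCox n))"
    and "\<And>i. i < n \<Longrightarrow> \<alpha> [i] = \<beta> [i]"
  shows "\<alpha> = \<beta>"
proof (rule extensionalityI[OF assms(3,4)])
  fix w assume "w \<in> carrier (UCox n)"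
  then show "\<alpha> w = \<beta> w"
  proof (induction w)
    case Nil
    then show ?case using assms by (simp add: hom_UCox_Nil)
  next
    case (Cons a w)
    moreover have "w \<in> carrier (UCox n)" "a < n"
      using Cons.prems by (auto simp: carrier_UCox distinct_adj_Cons)
    ultimately show ?case using assms hom_UCox_Cons by metis
  qed
qed

section \<open>Endomorphisms prescribed on the letters\<close>

definition letter_map :: "nat \<Rightarrow> (nat \<Rightarrow> nat list) \<Rightarrow> nat list \<Rightarrow> nat list" where
  "letter_map n h = (\<lambda>w\<in>carrier (UCox n). foldr (\<lambda>a. word_mult (h a)) w [])"

definition involutive_letters :: "nat \<Rightarrow> (nat \<Rightarrow> nat list) \<Rightarrow> bool" where
  "involutive_letters n h \<longleftrightarrow> (\<forall>i<n. h i \<in> carrier (UCox n) \<and> word_mult (h i) (h i) = [])"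

lemma letter_map_extensional [simp]: "letter_map n h \<in> extensional (carrier (UCox n))"
  by (simp add: letter_map_def)

lemma letter_map_letter: "involutive_letters n h \<Longrightarrow> i < n \<Longrightarrow> letter_map n h [i] = h i"
  by (simp add: letter_map_def involutive_letters_def carrier_UCox mult_Nil_right)

text \<open>The universal property of the presentation: the only relation to respect is the
  cancellation of two equal letters, which \<open>involutive_letters\<close> provides.\<close>

lemma letter_map_hom:
  assumes h: "involutive_letters n h"
  shows "letter_map n h \<in> hom (UCox n) (UCox n)"
proof -
  define f where "f w = foldr (\<lambda>a. word_mult (h a)) w []" for w
  have hW: "h a \<in> carrier (UCox n)" "word_mult (h a) (h a) = []" if "a < n" for a
    using h that by (auto simp: involutive_letters_def)
  have f_in: "f w \<in> carrier (UCox n)" if "set w \<subseteq> {..<n}" for w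
    using that by (induction w) (auto simp: f_def hW mult_in_UCox)
  have f_push: "f (push_letter a w) = word_mult (h a) (f w)" if "a < n" "set w \<subseteq> {..<n}" for a w
  proof (cases w)
    case (Cons b v)
    then have v: "distinct_adj (f v)" using f_in[of v] that by (simp add: carrier_UCox)
    have "word_mult (h a) (word_mult (h a) (f v)) = f v"
      using hW[OF that(1)] v by (simp flip: mult_assoc_word)
    then show ?thesis using Cons by (auto simp: f_def)
  qed (simp add: f_def)
  have f_mult: "f (word_mult u v) = word_mult (f u) (f v)" if "set u \<subseteq> {..<n}" "set v \<subseteq> {..<n}" for u v
    using that(1)
  proof (induction u)
    case Nil
    then show ?case by (simp add: f_def)
  next
    case (Cons a u)
    have "set (word_mult u v) \<subseteq> {..<n}" using set_mult[of u v] Cons that by auto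
    then have "f (word_mult (a # u) v) = word_mult (h a) (word_mult (f u) (f v))"
      using Cons by (simp add: f_push)
    also have "\<dots> = word_mult (f (a # u)) (f v)"
      using f_in[OF that(2)] by (simp add: f_def mult_assoc_word carrier_UCox)
    finally show ?case .
  qed
  show ?thesis
    by (rule homI) (simp_all add: letter_map_def mult_in_UCox flip: f_def,
        simp_all add: f_in f_mult carrier_UCox f_in[unfolded carrier_UCox])
qed

lemma AutoGroup_carrier: "carrier (AutoGroup (UCox n)) = auto (UCox n)"
  by (simp add: AutoGroup_def)

lemma AutoGroup_mult:
  assumes "\<alpha> \<in> auto (UCox n)" "\<beta> \<in> auto (UCox n)"
  shows "\<alpha> \<otimes>\<^bsub>AutoGroup (UCox n)\<^esub> \<beta> = compose (carrier (UCox n)) \<alpha> \<beta>"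
  using assms by (simp add: AutoGroup_def BijGroup_def auto_def)

lemma auto_hom: "\<alpha> \<in> auto (UCox n) \<Longrightarrow> \<alpha> \<in> hom (UCox n) (UCox n)"
  and auto_extensional: "\<alpha> \<in> auto (UCox n) \<Longrightarrow> \<alpha> \<in> extensional (carrier (UCox n))"
  by (auto simp: auto_def Bij_def)

lemma compose_hom_UCox:
  assumes "\<alpha> \<in> hom (UCox n) (UCox n)" "\<beta> \<in> hom (UCox n) (UCox n)"
  shows "compose (carrier (UCox n)) \<alpha> \<beta> \<in> hom (UCox n) (UCox n)"
  using group.hom_compose[OF group_UCox assms(2,1)] .

lemma auto_mult_eqI:
  assumes "\<alpha> \<in> auto (UCox n)" "\<beta> \<in> auto (UCox n)" "\<gamma> \<in> auto (UCox n)" "\<delta> \<in> auto (UCox n)"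
    and "\<And>i. i < n \<Longrightarrow> \<alpha> (\<beta> [i]) = \<gamma> (\<delta> [i])"
  shows "\<alpha> \<otimes>\<^bsub>AutoGroup (UCox n)\<^esub> \<beta> = \<gamma> \<otimes>\<^bsub>AutoGroup (UCox n)\<^esub> \<delta>"
  unfolding AutoGroup_mult[OF assms(1,2)] AutoGroup_mult[OF assms(3,4)]
  by (rule hom_UCox_eqI[of _ n]) (use assms in \<open>auto simp: compose_hom_UCox auto_hom compose_eq\<close>)

lemma letter_map_auto:
  assumes h: "involutive_letters n h" and k: "involutive_letters n k"
    and hk: "\<And>i. i < n \<Longrightarrow> letter_map n h (k i) = [i]"
    and kh: "\<And>i. i < n \<Longrightarrow> letter_map n k (h i) = [i]"
  shows "letter_map n h \<in> auto (UCox n)"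
proof -
  let ?W = "carrier (UCox n)"
  have id: "(\<lambda>x\<in>?W. x) \<in> hom (UCox n) (UCox n)"
    using group.id_in_auto[OF group_UCox] auto_hom by blast
  have inv: "letter_map n g (letter_map n g' w) = w"
    if g: "involutive_letters n g" "involutive_letters n g'" "w \<in> ?W"
      and gg: "\<And>i. i < n \<Longrightarrow> letter_map n g (g' i) = [i]" for g g' w
  proof -
    have "compose ?W (letter_map n g) (letter_map n g') = (\<lambda>x\<in>?W. x)"
      by (rule hom_UCox_eqI[of _ n])
        (use g gg id in \<open>auto simp: compose_hom_UCox letter_map_hom compose_eq letter_map_letter\<close>)
    then show ?thesis using g(3) by (metis compose_eq restrict_apply')
  qed
  have maps: "letter_map n g w \<in> ?W" if "involutive_letters n g" "w \<in> ?W" for g w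
    using letter_map_hom[OF that(1)] that(2) by (rule hom_in_carrier)
  have "bij_betw (letter_map n h) ?W ?W"
    by (rule bij_betw_byWitness[where f' = "letter_map n k"]) (use inv maps h k hk kh in auto)
  then show ?thesis using letter_map_hom[OF h] by (simp add: auto_def Bij_def)
qed

section \<open>Permutation automorphisms and partial conjugations\<close>

definition perm_aut :: "nat \<Rightarrow> (nat \<Rightarrow> nat) \<Rightarrow> nat list \<Rightarrow> nat list" where
  "perm_aut n \<pi> = letter_map n (\<lambda>i. [\<pi> i])"

definition conj_letter :: "nat \<Rightarrow> nat \<Rightarrow> nat \<Rightarrow> nat list" where
  "conj_letter a b i = (if i = b then [a, b, a] else [i])"

definition partial_conj :: "nat \<Rightarrow> nat \<Rightarrow> nat \<Rightarrow> nat list \<Rightarrow> nat list" where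
  "partial_conj n a b = letter_map n (conj_letter a b)"

lemma involutive_perm: "\<pi> permutes {..<n} \<Longrightarrow> involutive_letters n (\<lambda>i. [\<pi> i])"
  using permutes_in_image[of \<pi> "{..<n}"] by (auto simp: involutive_letters_def)

lemma involutive_conj: "a < n \<Longrightarrow> b < n \<Longrightarrow> a \<noteq> b \<Longrightarrow> involutive_letters n (conj_letter a b)"
  by (auto simp: involutive_letters_def conj_letter_def carrier_UCox)

lemma perm_aut_letter: "\<pi> permutes {..<n} \<Longrightarrow> i < n \<Longrightarrow> perm_aut n \<pi> [i] = [\<pi> i]"
  by (simp add: perm_aut_def letter_map_letter involutive_perm)

lemma partial_conj_letter:
  "a < n \<Longrightarrow> b < n \<Longrightarrow> a \<noteq> b \<Longrightarrow> i < n \<Longrightarrow> partial_conj n a b [i] = conj_letter a b i"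
  by (simp add: partial_conj_def letter_map_letter involutive_conj)

lemma perm_aut_auto:
  assumes "\<pi> permutes {..<n}"
  shows "perm_aut n \<pi> \<in> auto (UCox n)"
proof -
  have inv: "inv_into UNIV \<pi> permutes {..<n}" using assms by (rule permutes_inv)
  have lt: "\<pi> i < n" "inv_into UNIV \<pi> i < n" if "i < n" for i
    using permutes_in_image[OF assms] permutes_in_image[OF inv] that by auto
  show ?thesis unfolding perm_aut_def
    by (rule letter_map_auto[where k = "\<lambda>i. [inv_into UNIV \<pi> i]"])
      (use assms inv lt in \<open>auto simp: involutive_perm letter_map_letter permutes_inverses\<close>)
qed

lemma hom_conj_letter:
  assumes "\<alpha> \<in> hom (UCox n) (UCox n)" "a < n" "b < n" "a \<noteq> b" "i < n"
  shows "\<alpha> (conj_letter a b i) =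
    (if i = b then word_mult (\<alpha> [a]) (word_mult (\<alpha> [b]) (\<alpha> [a])) else \<alpha> [i])"
proof (cases "i = b")
  case True
  have "[a, b, a] \<in> carrier (UCox n)" "[b, a] \<in> carrier (UCox n)"
    using assms by (auto simp: carrier_UCox)
  then show ?thesis using True hom_UCox_Cons[OF assms(1)] by (simp add: conj_letter_def)
qed (simp add: conj_letter_def)

lemma partial_conj_twice:
  assumes "a < n" "b < n" "a \<noteq> b" "i < n"
  shows "partial_conj n a b (partial_conj n a b [i]) = [i]"
proof -
  have "partial_conj n a b \<in> hom (UCox n) (UCox n)"
    using assms by (simp add: partial_conj_def letter_map_hom involutive_conj)
  then show ?thesis using assms
    by (simp add: partial_conj_letter hom_conj_letter) (auto simp: conj_letter_def)
qed

lemma partial_conj_auto: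
  assumes "a < n" "b < n" "a \<noteq> b"
  shows "partial_conj n a b \<in> auto (UCox n)"
  unfolding partial_conj_def
  by (rule letter_map_auto[where k = "conj_letter a b"])
    (use assms partial_conj_twice[OF assms] in
      \<open>auto simp: involutive_conj letter_map_letter partial_conj_def\<close>)

lemma partial_conj_involution:
  assumes "a < n" "b < n" "a \<noteq> b"
  shows "partial_conj n a b \<otimes>\<^bsub>AutoGroup (UCox n)\<^esub> partial_conj n a b = \<one>\<^bsub>AutoGroup (UCox n)\<^esub>"
proof -
  interpret A: group "AutoGroup (UCox n)" by (rule group.AutoGroup[OF group_UCox])
  have one: "\<one>\<^bsub>AutoGroup (UCox n)\<^esub> = (\<lambda>w\<in>carrier (UCox n). w)"
    by (simp add: AutoGroup_def BijGroup_def)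
  have one_in: "\<one>\<^bsub>AutoGroup (UCox n)\<^esub> \<in> auto (UCox n)"
    using A.one_closed by (simp only: AutoGroup_carrier)
  have "partial_conj n a b \<otimes>\<^bsub>AutoGroup (UCox n)\<^esub> partial_conj n a b
      = \<one>\<^bsub>AutoGroup (UCox n)\<^esub> \<otimes>\<^bsub>AutoGroup (UCox n)\<^esub> \<one>\<^bsub>AutoGroup (UCox n)\<^esub>"
    by (rule auto_mult_eqI)
      (use assms partial_conj_auto partial_conj_twice one_in in \<open>auto simp: one\<close>)
  then show ?thesis by simp
qed

lemma perm_aut_compose:
  assumes "\<pi> permutes {..<n}" "\<pi>' permutes {..<n}"
  shows "perm_aut n \<pi> \<otimes>\<^bsub>AutoGroup (UCox n)\<^esub> perm_aut n \<pi>' = perm_aut n (\<pi> \<circ> \<pi>')"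
proof -
  have c: "\<pi> \<circ> \<pi>' permutes {..<n}" using assms by (simp add: permutes_compose)
  show ?thesis
    unfolding AutoGroup_mult[OF perm_aut_auto[OF assms(1)] perm_aut_auto[OF assms(2)]]
    by (rule hom_UCox_eqI[of _ n])
      (use assms c permutes_in_image[OF assms(2)] in
        \<open>auto simp: compose_hom_UCox auto_hom perm_aut_auto auto_extensional compose_eq perm_aut_letter\<close>)
qed

lemma perm_aut_partial_conj:
  assumes "\<pi> permutes {..<n}" "a < n" "b < n" "a \<noteq> b"
  shows "perm_aut n \<pi> \<otimes>\<^bsub>AutoGroup (UCox n)\<^esub> partial_conj n a b
    = partial_conj n (\<pi> a) (\<pi> b) \<otimes>\<^bsub>AutoGroup (UCox n)\<^esub> perm_aut n \<pi>"
proof -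
  have lt: "\<pi> i < n" if "i < n" for i using permutes_in_image[OF assms(1)] that by auto
  have ne: "\<pi> i = \<pi> j \<longleftrightarrow> i = j" for i j using permutes_inj[OF assms(1)] by (auto simp: inj_def)
  have hom: "perm_aut n \<pi> \<in> hom (UCox n) (UCox n)"
    using assms by (simp add: perm_aut_auto auto_hom)
  show ?thesis
  proof (rule auto_mult_eqI)
    fix i assume i: "i < n"
    show "perm_aut n \<pi> (partial_conj n a b [i]) = partial_conj n (\<pi> a) (\<pi> b) (perm_aut n \<pi> [i])"
      using assms i lt ne
      by (simp add: partial_conj_letter hom_conj_letter[OF hom] perm_aut_letter)
        (auto simp: conj_letter_def)
  qed (use assms lt ne in \<open>simp_all add: partial_conj_auto perm_aut_auto\<close>)
qed

text \<open>The case \<open>a = a'\<close> is included: it serves the conjugations by one letter,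
  while disjoint pairs serve distinct blocks.\<close>

lemma partial_conj_commute:
  assumes "a < n" "b < n" "a \<noteq> b" "a' < n" "b' < n" "a' \<noteq> b'"
    and "a \<noteq> b'" "a' \<noteq> b" "b \<noteq> b'"
  shows "partial_conj n a b \<otimes>\<^bsub>AutoGroup (UCox n)\<^esub> partial_conj n a' b'
    = partial_conj n a' b' \<otimes>\<^bsub>AutoGroup (UCox n)\<^esub> partial_conj n a b"
proof (rule auto_mult_eqI)
  have hom: "partial_conj n a b \<in> hom (UCox n) (UCox n)" "partial_conj n a' b' \<in> hom (UCox n) (UCox n)"
    using assms by (simp_all add: partial_conj_auto auto_hom)
  fix i assume i: "i < n"
  show "partial_conj n a b (partial_conj n a' b' [i]) = partial_conj n a' b' (partial_conj n a b [i])"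
    using assms i
    by (simp add: partial_conj_letter hom_conj_letter[OF hom(1)] hom_conj_letter[OF hom(2)])
      (simp add: conj_letter_def)
qed (use assms in \<open>simp_all add: partial_conj_auto\<close>)

section \<open>Palindromes and Nielsen reduction\<close>

lemma palindrome_split:
  assumes "distinct_adj u" "rev u = u" "u \<noteq> []"
  obtains w x where "u = w @ [x] @ rev w"
  using assms
proof (induction "length u" arbitrary: u thesis rule: less_induct)
  case less
  obtain a v where u: "u = a # v" using less.prems(4) by (cases u) auto
  show ?case
  proof (cases "v = []")
    case True
    then show ?thesis using less.prems(1)[of "[]" a] u by simp
  next
    case False
    then obtain v' b where v: "v = v' @ [b]" by (cases v rule: rev_cases) auto
    have eq: "b # rev v' @ [a] = a # v' @ [b]"
      using less.prems(3) by (simp only: u v rev.simps rev_append append.simps append_assoc)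
    then have ab: "b = a" by (simp only: list.inject)
    have pal: "rev v' = v'" using eq by (simp add: ab)
    \<comment> \<open>Reducedness enters here: a palindrome of even length would have two equal
      adjacent letters in the middle.\<close>
    have "v' \<noteq> []" using less.prems(2) by (auto simp: u v ab)
    moreover have "distinct_adj v'"
    proof -
      have "distinct_adj ([a] @ (v' @ [b]))" using less.prems(2) by (simp only: u v append.simps)
      then show ?thesis by (simp only: distinct_adj_append_iff)
    qed
    moreover have "length v' < length u" by (simp only: u v length_Cons length_append)
    ultimately obtain w x where "v' = w @ [x] @ rev w"
      using less.hyps[OF _ _ _ pal] by metis
    then show ?thesis using less.prems(1)[of "a # w" x] u v ab by simp
  qed
qed

text \<open>The ping-pong step: unless \<open>u\<close> itself starts with \<open>w @ [x]\<close>,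
  multiplying it by \<open>rev w\<close> leaves a word not starting with \<open>x\<close>, so the
  letter \<open>x\<close> is not cancelled.\<close>

lemma mult_palindrome_prefix:
  assumes "distinct_adj (w @ [x])" "distinct_adj u" "\<not> prefix (w @ [x]) u"
  shows "prefix (w @ [x]) (word_mult (w @ [x] @ rev w) u)"
proof -
  define v where "v = word_mult (rev w) u"
  have v: "distinct_adj v" using assms by (simp add: v_def)
  have glue: "word_mult w (x # v') = w @ x # v'" if "distinct_adj (x # v')" for v'
    using assms(1) that by (intro mult_append) (auto simp: distinct_adj_append_iff)
  have "v \<noteq> x # v'" for v'
  proof
    assume eq: "v = x # v'"
    have "u = word_mult w v" using assms(2) by (simp add: v_def mult_cancel_rev)
    then have "u = w @ x # v'" using glue v eq by simp
    then show False using assms(3) by (auto simp: prefix_def)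
  qed
  then have "distinct_adj (x # v)" using v by (cases v) (auto simp: distinct_adj_Cons)
  then show ?thesis using glue push_Cons by (simp add: v_def[symmetric])
qed

text \<open>Nielsen reduction. Automorphisms send letters to palindromes \<open>w x w\<^sup>-\<^sup>1\<close>. If some
half \<open>w x\<close> is a prefix of another one, a partial conjugation shortens the images; otherwise
the sets of words with prefix \<open>w x\<close> form a ping-pong table, and surjectivity forces every
\<open>w\<close> to be empty.\<close>

lemma auto_UCox_induct [consumes 1, case_names perm conj]:
  assumes \<alpha>: "\<alpha> \<in> auto (UCox n)"
    and perm: "\<And>\<pi>. \<pi> permutes {..<n} \<Longrightarrow> Q (perm_aut n \<pi>)"
    and step: "\<And>\<alpha> a b. \<alpha> \<in> auto (UCox n) \<Longrightarrow> a < n \<Longrightarrow> b < n \<Longrightarrow> a \<noteq> b \<Longrightarrow>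
      Q (\<alpha> \<otimes>\<^bsub>AutoGroup (UCox n)\<^esub> partial_conj n a b) \<Longrightarrow> Q \<alpha>"
  shows "Q \<alpha>"
  using \<alpha>
proof (induction "\<Sum>i<n. length (\<alpha> [i])" arbitrary: \<alpha> rule: less_induct)
  case less
  note \<alpha> = less.prems
  note hom = auto_hom[OF \<alpha>]
  have inj: "inj_on \<alpha> (carrier (UCox n))" and surj: "\<alpha> ` carrier (UCox n) = carrier (UCox n)"
    using \<alpha> by (auto simp: auto_def Bij_def bij_betw_def)
  have red: "distinct_adj (\<alpha> w)" "set (\<alpha> w) \<subseteq> {..<n}" if "w \<in> carrier (UCox n)" for w
    using hom_in_carrier[OF hom that] by (auto simp: carrier_UCox)
  \<comment> \<open>The image of a letter squares to 1, so it equals its inverse, which is the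
    reversed word.\<close>
  have "\<exists>w x. \<alpha> [i] = w @ [x] @ rev w" if i: "i < n" for i
  proof -
    have sq: "word_mult (\<alpha> [i]) (\<alpha> [i]) = []"
      using hom_mult[OF hom, of "[i]" "[i]"] i hom_UCox_Nil[OF hom] by simp
    have "rev (\<alpha> [i]) = \<alpha> [i]"
      using mult_rev_cancel[of "\<alpha> [i]" "\<alpha> [i]"] red[of "[i]"] i by (simp add: sq mult_Nil_right)
    moreover have "\<alpha> [i] \<noteq> []"
      using inj_onD[OF inj, of "[i]" "[]"] i hom_UCox_Nil[OF hom] by auto
    ultimately show ?thesis using palindrome_split red[of "[i]"] i by (metis letter_in_UCox)
  qed
  then obtain w x where wx: "\<And>i. i < n \<Longrightarrow> \<alpha> [i] = w i @ [x i] @ rev (w i)" by metis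
  have half: "distinct_adj (w i @ [x i])" if "i < n" for i
  proof -
    have "distinct_adj ((w i @ [x i]) @ rev (w i))"
      using red[of "[i]"] wx[OF that] that by simp
    then show ?thesis by (simp only: distinct_adj_append_iff)
  qed
  have wred: "distinct_adj (w i)" "distinct_adj (rev (w i))" if "i < n" for i
    using half[OF that] by (auto simp: distinct_adj_append_iff)
  show ?case
  proof (cases "\<exists>i j. i < n \<and> j < n \<and> i \<noteq> j \<and> prefix (w j @ [x j]) (w i @ [x i])")
    case True
    then obtain i j where ij: "i < n" "j < n" "i \<noteq> j" and pre: "prefix (w j @ [x j]) (w i @ [x i])"
      by blast
    have "w j @ [x j] \<noteq> w i @ [x i]"
      using inj_onD[OF inj, of "[i]" "[j]"] wx ij by auto
    \<comment> \<open>Conjugating by letter \<open>j\<close> replaces the half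
      \<open>w j @ [x j] @ u @ [x i]\<close> by \<open>w j @ u @ [x i]\<close>; the letter
      \<open>x j\<close> disappears on both sides.\<close>
    then obtain u where u: "w i = w j @ [x j] @ u"
      using pre by (auto simp: prefix_def append_eq_append_conv2 append_eq_Cons_conv Cons_eq_append_conv)
    let ?\<beta> = "\<alpha> \<otimes>\<^bsub>AutoGroup (UCox n)\<^esub> partial_conj n j i"
    have \<sigma>: "partial_conj n j i \<in> auto (UCox n)" using ij by (simp add: partial_conj_auto)
    have \<beta>: "?\<beta> \<in> auto (UCox n)"
      using monoid.m_closed[OF group.is_monoid[OF group.AutoGroup[OF group_UCox]], of \<alpha> n] \<alpha> \<sigma>
      by (simp add: AutoGroup_carrier)
    have \<beta>l: "?\<beta> [k] = (if k = i then word_mult (\<alpha> [j]) (word_mult (\<alpha> [i]) (\<alpha> [j])) else \<alpha> [k])"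
      if "k < n" for k
      using that ij by (simp add: AutoGroup_mult[OF \<alpha> \<sigma>] compose_eq partial_conj_letter hom_conj_letter[OF hom])
    have "\<alpha> [j] = word_mult (w j) (push_letter (x j) (rev (w j)))"
      using mult_append[of "w j @ [x j]" "rev (w j)"] wx[OF ij(2)] red[of "[j]"] ij by simp
    then have "word_mult (\<alpha> [i]) (\<alpha> [j]) = word_mult (w j @ [x j] @ u @ [x i] @ rev u) (rev (w j))"
      using wx[OF ij(1)] u wred[OF ij(2)] distinct_adj_push
      by (simp add: mult_rev_cancel push_push)
    then have "word_mult (\<alpha> [j]) (word_mult (\<alpha> [i]) (\<alpha> [j])) = word_mult (w j @ u @ [x i] @ rev u) (rev (w j))"
      using wx[OF ij(2)] wred[OF ij(2)] distinct_adj_push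
      by (simp add: mult_rev_cancel push_push)
    then have "length (?\<beta> [i]) < length (\<alpha> [i])"
      using length_mult[of "w j @ u @ [x i] @ rev u" "rev (w j)"] wx[OF ij(1)] u \<beta>l[OF ij(1)]
      by (simp del: word_mult_append)
    moreover have "length (?\<beta> [k]) \<le> length (\<alpha> [k])" if "k < n" for k
      using calculation \<beta>l[OF that] by (cases "k = i") auto
    ultimately have "(\<Sum>k<n. length (?\<beta> [k])) < (\<Sum>k<n. length (\<alpha> [k]))"
      using ij by (intro sum_strict_mono_ex1) auto
    then have "Q ?\<beta>" using less.hyps \<beta> by blast
    then show ?thesis using step \<alpha> ij by metis
  next
    case False
    \<comment> \<open>If the image of \<open>k # v\<close> already began with the half of
      \<open>i\<close>, the halves of \<open>i\<close> and \<open>k\<close> would be prefixes of one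
      word, hence comparable.\<close>
    have ping: "prefix (w i @ [x i]) (\<alpha> (i # v))" if "i # v \<in> carrier (UCox n)" for i v
      using that
    proof (induction v arbitrary: i)
      case Nil
      then show ?case using wx[of i] by simp
    next
      case (Cons k v)
      have v: "k # v \<in> carrier (UCox n)" and ik: "i < n" "k < n" "i \<noteq> k"
        using Cons.prems by (auto simp: carrier_UCox)
      have "\<not> prefix (w i @ [x i]) (\<alpha> (k # v))"
        using Cons.IH[OF v] False ik prefix_same_cases by blast
      then show ?case
        using mult_palindrome_prefix[OF half[OF ik(1)] red(1)[OF v]] hom_UCox_Cons[OF hom Cons.prems]
          wx[OF ik(1)] by simp
    qed
    have letter: "\<exists>i<n. \<alpha> [i] = [j]" if j: "j < n" for j
    proof -
      have "[j] \<in> \<alpha> ` carrier (UCox n)" using j surj by simp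
      then obtain g where g: "g \<in> carrier (UCox n)" "\<alpha> g = [j]" by auto
      then obtain i v where v: "g = i # v" using hom_UCox_Nil[OF hom] by (cases g) auto
      have i: "i < n" using g v by (auto simp: carrier_UCox)
      \<comment> \<open>Surjectivity at work: a half that is a prefix of a one-letter word has
        length one.\<close>
      have "prefix (w i @ [x i]) [j]" using ping[of i v] g v by simp
      then have "w i = []" "x i = j" by (auto simp: prefix_Cons)
      then show ?thesis using wx[OF i] i by auto
    qed
    define \<pi> where "\<pi> i = (if i < n then hd (\<alpha> [i]) else i)" for i
    \<comment> \<open>Each of the \<open>n\<close> letters is the image of a letter, so by counting
      every letter is sent to a letter.\<close>
    define I where "I = {i. i < n \<and> (\<exists>j<n. \<alpha> [i] = [j])}"
    have "{..<n} \<subseteq> (\<lambda>i. hd (\<alpha> [i])) ` I" using letter unfolding I_def by force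
    then have "n \<le> card I" using surj_card_le[of I "{..<n}"] by (simp add: I_def)
    then have "I = {..<n}" by (intro card_seteq) (auto simp: I_def)
    then have img: "\<alpha> [i] = [\<pi> i]" "\<pi> i < n" if "i < n" for i
    proof -
      have "i \<in> I" using \<open>I = {..<n}\<close> that by simp
      then show "\<alpha> [i] = [\<pi> i]" "\<pi> i < n" by (auto simp: I_def \<pi>_def)
    qed
    have "inj_on \<pi> {..<n}"
    proof (rule inj_onI)
      fix i j assume "i \<in> {..<n}" "j \<in> {..<n}" "\<pi> i = \<pi> j"
      then show "i = j" using inj_onD[OF inj, of "[i]" "[j]"] img by simp
    qed
    moreover have "\<pi> ` {..<n} = {..<n}"
      by (rule endo_inj_surj) (use img calculation in auto)
    ultimately have "bij_betw \<pi> {..<n} {..<n}"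
      by (simp add: bij_betw_def)
    then have p: "\<pi> permutes {..<n}" by (rule bij_imp_permutes) (simp add: \<pi>_def)
    have "\<alpha> = perm_aut n \<pi>"
      by (rule hom_UCox_eqI[of _ n])
        (use p img hom \<alpha> in \<open>auto simp: perm_aut_letter auto_hom auto_extensional perm_aut_auto\<close>)
    then show ?thesis using perm[OF p] by simp
  qed
qed

subsection \<open>Actions of the automorphism group\<close>

locale aut_action = CAT0_geodesics M d G for M :: "'x set" and d and G +
  fixes n :: nat and \<rho> :: "(nat list \<Rightarrow> nat list) \<Rightarrow> 'x \<Rightarrow> 'x"
  assumes compl: "mcomplete" and nonempty: "M \<noteq> {}" and n2: "2 \<le> n"
    and action: "isometric_action (AutoGroup (UCox n)) M d \<rho>"
begin

abbreviation mult_aut (infixl "\<odot>" 70) where "g \<odot> h \<equiv> g \<otimes>\<^bsub>AutoGroup (UCox n)\<^esub> h"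

section \<open>Common fixed points of sets of automorphisms\<close>

lemma act_in: "g \<in> auto (UCox n) \<Longrightarrow> x \<in> M \<Longrightarrow> \<rho> g x \<in> M"
  using action group_action.element_image by (metis isometric_action_def AutoGroup_carrier)

lemma act_mult:
  assumes "g \<in> auto (UCox n)" "h \<in> auto (UCox n)" "x \<in> M"
  shows "\<rho> (g \<odot> h) x = \<rho> g (\<rho> h x)"
  using action assms group_action.composition_rule[of "AutoGroup (UCox n)" M \<rho> x g h]
  by (simp add: isometric_action_def AutoGroup_carrier)

lemma act_one: "x \<in> M \<Longrightarrow> \<rho> \<one>\<^bsub>AutoGroup (UCox n)\<^esub> x = x"
  using action group_action.id_eq_one[of "AutoGroup (UCox n)" M \<rho>]
  by (metis isometric_action_def restrict_apply')

lemma act_isometry: "g \<in> auto (UCox n) \<Longrightarrow> isometry (\<rho> g)"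
  using action act_in by (auto simp: isometry_def isometric_action_def AutoGroup_carrier)

definition fixable :: "(nat list \<Rightarrow> nat list) set \<Rightarrow> bool" where
  "fixable X \<longleftrightarrow> (\<exists>x\<in>M. \<forall>g\<in>X. \<rho> g x = x)"

lemma fixable_mono: "fixable Y \<Longrightarrow> X \<subseteq> Y \<Longrightarrow> fixable X"
  by (auto simp: fixable_def)

lemma fixable_empty: "fixable {}"
  using nonempty by (auto simp: fixable_def)

lemma fixable_Un:
  assumes X: "X \<subseteq> auto (UCox n)" and Y: "Y \<subseteq> auto (UCox n)"
    and comm: "\<And>g h. g \<in> X \<Longrightarrow> h \<in> Y \<Longrightarrow> g \<odot> h = h \<odot> g"
    and fX: "fixable X" and fY: "fixable Y"
  shows "fixable (X \<union> Y)"
proof -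
  obtain x y where x: "x \<in> M" "\<And>g. g \<in> X \<Longrightarrow> \<rho> g x = x" and y: "y \<in> M" "\<And>g. g \<in> Y \<Longrightarrow> \<rho> g y = y"
    using fX fY by (auto simp: fixable_def)
  have c: "\<rho> g (\<rho> h u) = \<rho> h (\<rho> g u)" if "g \<in> X" "h \<in> Y" "u \<in> M" for g h u
  proof -
    have "g \<in> auto (UCox n)" "h \<in> auto (UCox n)" using X Y that by auto
    then show ?thesis using comm[OF that(1,2)] act_mult[of g h u] act_mult[of h g u] that(3) by simp
  qed
  show ?thesis
  proof (rule fixed_sets_commuting[OF compl, of "\<rho> ` X" "\<rho> ` Y" x y])
    fix z assume "z \<in> M" "\<And>f. f \<in> \<rho> ` X \<union> \<rho> ` Y \<Longrightarrow> f z = z"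
    then show ?thesis unfolding fixable_def by (intro bexI[of _ z]) auto
  qed (use x y X Y c act_isometry in auto)
qed

text \<open>The centre of an orbit, taken inside an invariant convex set; the freedom in
  \<open>C\<close> is what handles semidirect products.\<close>

lemma perms_fix_point:
  assumes C: "geod_convex C" "closedin mtopology C" "C \<noteq> {}" and S: "S \<subseteq> {..<n}"
    and inv: "\<And>\<pi> x. \<pi> permutes S \<Longrightarrow> x \<in> C \<Longrightarrow> \<rho> (perm_aut n \<pi>) x \<in> C"
  obtains z where "z \<in> C" "\<And>\<pi>. \<pi> permutes S \<Longrightarrow> \<rho> (perm_aut n \<pi>) z = z"
proof -
  obtain p where p: "p \<in> C" using C by blast
  then have pM: "p \<in> M" using C by (auto simp: geod_convex_def)
  define A where "A = (\<lambda>\<pi>. \<rho> (perm_aut n \<pi>) p) ` {\<pi>. \<pi> permutes S}"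
  have Sn: "\<pi> permutes {..<n}" if "\<pi> permutes S" for \<pi>
    using permutes_subset[OF that S] .
  have "finite S" using S finite_subset by blast
  then have "finite A" "A \<subseteq> M"
    using pM act_in[OF perm_aut_auto[OF Sn]] finite_permutations[of S] by (auto simp: A_def)
  moreover have "A \<noteq> {}" using permutes_id[of S] unfolding A_def by blast
  ultimately have A: "finite A" "A \<noteq> {}" "A \<subseteq> M" by auto
  have AA: "\<rho> (perm_aut n \<pi>) ` A = A" if \<pi>: "\<pi> permutes S" for \<pi>
  proof -
    have "\<rho> (perm_aut n \<pi>) ` A = (\<lambda>\<pi>'. \<rho> (perm_aut n (\<pi> \<circ> \<pi>')) p) ` {\<pi>'. \<pi>' permutes S}"
      unfolding A_def image_image
      by (rule image_cong) (simp_all add: perm_aut_compose[symmetric] Sn \<pi> act_mult perm_aut_auto pM)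
    also have "\<dots> = (\<lambda>\<pi>'. \<rho> (perm_aut n \<pi>') p) ` {\<pi> \<circ> \<pi>' |\<pi>'. \<pi>' permutes S}"
      by auto
    finally show ?thesis unfolding image_compose_permutations_left[OF \<pi>] A_def .
  qed
  obtain z where z: "z \<in> C" "\<And>f. isometry f \<Longrightarrow> f ` A = A \<Longrightarrow> f ` C \<subseteq> C \<Longrightarrow> f z = z"
    using center_exists[OF compl C A] by metis
  have "\<rho> (perm_aut n \<pi>) z = z" if \<pi>: "\<pi> permutes S" for \<pi>
    by (rule z(2)) (use act_isometry[OF perm_aut_auto[OF Sn[OF \<pi>]]] AA[OF \<pi>] inv[OF \<pi>] in auto)
  then show ?thesis using that z(1) by blast
qed

lemma fixable_perms: "fixable (perm_aut n ` {\<pi>. \<pi> permutes {..<n}})"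
proof -
  obtain z where "z \<in> M" "\<And>\<pi>. \<pi> permutes {..<n} \<Longrightarrow> \<rho> (perm_aut n \<pi>) z = z"
    using perms_fix_point[OF geod_convex_M _ nonempty subset_refl] act_in perm_aut_auto by auto
  then show ?thesis by (auto simp: fixable_def)
qed

lemma fixable_partial_conj:
  assumes ab: "a < n" "b < n" "a \<noteq> b"
  shows "fixable {partial_conj n a b}"
proof -
  let ?\<sigma> = "partial_conj n a b"
  have \<sigma>: "?\<sigma> \<in> auto (UCox n)" using ab by (rule partial_conj_auto)
  obtain x where x: "x \<in> M" using nonempty by blast
  have "\<rho> ?\<sigma> (\<rho> ?\<sigma> x) = x"
    using act_mult[OF \<sigma> \<sigma> x] partial_conj_involution[OF ab] act_one[OF x] by simp
  then have img: "\<rho> ?\<sigma> ` {x, \<rho> ?\<sigma> x} = {x, \<rho> ?\<sigma> x}" by auto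
  obtain z where z: "z \<in> M"
    "\<And>f. isometry f \<Longrightarrow> f ` {x, \<rho> ?\<sigma> x} = {x, \<rho> ?\<sigma> x} \<Longrightarrow> f ` M \<subseteq> M \<Longrightarrow> f z = z"
    by (rule center_exists[OF compl geod_convex_M _ nonempty, of "{x, \<rho> ?\<sigma> x}"])
      (use x act_in[OF \<sigma>] in auto)
  have "\<rho> ?\<sigma> z = z"
    by (rule z(2)[OF act_isometry[OF \<sigma>] img]) (use act_in[OF \<sigma>] in auto)
  then show ?thesis using z(1) by (auto simp: fixable_def)
qed

lemma fixable_partial_conjs:
  assumes a: "a < n" and "finite B" and B: "B \<subseteq> {..<n} - {a}"
  shows "fixable (partial_conj n a ` B)"
  using assms(2) B
proof (induction B)
  case (insert b B)
  have "fixable ({partial_conj n a b} \<union> partial_conj n a ` B)"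
    by (rule fixable_Un)
      (use insert a in \<open>auto simp: fixable_partial_conj intro!: partial_conj_auto partial_conj_commute\<close>)
  then show ?case by simp
qed (simp add: fixable_empty)

text \<open>These elements generate a semidirect product of an elementary abelian 2-group with a
  symmetric group. Permutations fixing \<open>a\<close> normalise the conjugations by
  \<open>a\<close>, hence preserve their common fixed set \<open>C\<close>, and a centre can be
  found in \<open>C\<close>.\<close>

lemma fixable_star:
  assumes a: "a < n"
  shows "fixable (partial_conj n a ` ({..<n} - {a}) \<union> perm_aut n ` {\<pi>. \<pi> permutes {..<n} - {a}})"
proof -
  let ?B = "{..<n} - {a}"
  define C where "C = (\<Inter>b\<in>?B. {x \<in> M. \<rho> (partial_conj n a b) x = x})"
  \<comment> \<open>Some letter other than \<open>a\<close>; with an empty index set the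
    intersection \<open>C\<close> would be the whole type instead of a subset of
    \<open>M\<close>.\<close>
  have "(if a = 0 then 1 else 0) \<in> ?B" using n2 by auto
  then have B: "?B \<noteq> {}" by blast
  have \<sigma>: "partial_conj n a b \<in> auto (UCox n)" if "b \<in> ?B" for b
    using that a by (auto intro: partial_conj_auto)
  have C: "geod_convex C" "closedin mtopology C"
    unfolding C_def
    by (rule geod_convex_INT[OF B], rule geod_convex_fixed[OF act_isometry[OF \<sigma>]], assumption)
      (rule closedin_Inter, use B in blast, use closedin_fixed[OF act_isometry[OF \<sigma>]] in blast)
  have C0: "C \<noteq> {}"
    using fixable_partial_conjs[OF a, of ?B] by (auto simp: C_def fixable_def)
  have CM: "x \<in> M" and Cfix: "\<And>b. b \<in> ?B \<Longrightarrow> \<rho> (partial_conj n a b) x = x" if "x \<in> C" for x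
    using that B by (auto simp: C_def)
  have inv: "\<rho> (perm_aut n \<pi>) x \<in> C" if \<pi>: "\<pi> permutes ?B" and x: "x \<in> C" for \<pi> x
  proof -
    have \<pi>n: "\<pi> permutes {..<n}" using permutes_subset[OF \<pi>] by auto
    have \<pi>a: "\<pi> a = a" using \<pi> by (auto simp: permutes_def)
    have "\<rho> (partial_conj n a b) (\<rho> (perm_aut n \<pi>) x) = \<rho> (perm_aut n \<pi>) x" if b: "b \<in> ?B" for b
    proof -
      have "b \<in> \<pi> ` ?B" using permutes_image[OF \<pi>] b by (simp only:)
      then obtain c where c: "c \<in> ?B" "\<pi> c = b" by (elim imageE) simp
      have "perm_aut n \<pi> \<odot> partial_conj n a c = partial_conj n a b \<odot> perm_aut n \<pi>"
        using perm_aut_partial_conj[OF \<pi>n, of a c] c a \<pi>a by simp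
      then have "\<rho> (partial_conj n a b) (\<rho> (perm_aut n \<pi>) x) = \<rho> (perm_aut n \<pi>) (\<rho> (partial_conj n a c) x)"
        using act_mult[OF \<sigma>[OF b] perm_aut_auto[OF \<pi>n] CM[OF x]]
          act_mult[OF perm_aut_auto[OF \<pi>n] \<sigma>[OF c(1)] CM[OF x]] by simp
      then show ?thesis using Cfix[OF x c(1)] by simp
    qed
    then show ?thesis using act_in[OF perm_aut_auto[OF \<pi>n] CM[OF x]] by (auto simp: C_def)
  qed
  obtain z where z: "z \<in> C" "\<And>\<pi>. \<pi> permutes ?B \<Longrightarrow> \<rho> (perm_aut n \<pi>) z = z"
    using perms_fix_point[OF C C0 Diff_subset inv] by blast
  show ?thesis unfolding fixable_def
    by (rule bexI[of _ z]) (use z CM[OF z(1)] Cfix[OF z(1)] in auto)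
qed

text \<open>For \<open>s < q\<close> these elements generate the copy of \<open>Aut(W_q)\<close> acting on the letters
\<open>a, \<dots>, a + q - 1\<close>.\<close>

definition block_gen :: "nat \<Rightarrow> nat \<Rightarrow> nat list \<Rightarrow> nat list" where
  "block_gen a s = (if s = 0 then partial_conj n a (a + 1)
    else perm_aut n (Transposition.transpose (a + s - 1) (a + s)))"

section \<open>Blocks of letters\<close>

lemma block_gen_auto:
  assumes "2 \<le> q" "s < q" "a + q \<le> n"
  shows "block_gen a s \<in> auto (UCox n)"
  using assms by (auto simp: block_gen_def intro!: partial_conj_auto perm_aut_auto permutes_swap_id)

text \<open>Serves twice: to carry fixed points from block to block, and with \<open>b = a\<close>
  as the commutation with permutations that fix a block pointwise.\<close>

lemma block_gen_conj:
  assumes \<pi>: "\<pi> permutes {..<n}" and q: "2 \<le> q" "s < q" "a + q \<le> n" "b + q \<le> n"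
    and shift: "\<And>r. r < q \<Longrightarrow> \<pi> (a + r) = b + r"
  shows "perm_aut n \<pi> \<odot> block_gen a s = block_gen b s \<odot> perm_aut n \<pi>"
proof (cases "s = 0")
  case True
  then show ?thesis
    using perm_aut_partial_conj[OF \<pi>, of a "a + 1"] shift[of 0] shift[of 1] q by (simp add: block_gen_def)
next
  case False
  let ?i = "a + s - 1" and ?j = "b + s - 1"
  have "\<pi> \<circ> Transposition.transpose ?i (a + s) = Transposition.transpose (\<pi> ?i) (\<pi> (a + s)) \<circ> \<pi>"
    using transpose_apply_commute[of \<pi> "\<pi> ?i" "\<pi> (a + s)"] permutes_bij[OF \<pi>] permutes_inverses[OF \<pi>]
    by (auto simp: fun_eq_iff Transposition.transpose_def inj_eq[OF permutes_inj[OF \<pi>]])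
  moreover have "\<pi> ?i = ?j" "\<pi> (a + s) = b + s"
    using shift[of "s - 1"] shift[of s] q False by auto
  moreover have "Transposition.transpose ?i (a + s) permutes {..<n}"
    "Transposition.transpose ?j (b + s) permutes {..<n}"
    using q by (auto intro!: permutes_swap_id)
  ultimately show ?thesis using False \<pi> by (simp add: block_gen_def perm_aut_compose)
qed

lemma block_gen_perm_commute:
  assumes \<pi>: "\<pi> permutes {..<n}" and q: "2 \<le> q" "s < q" "a + q \<le> n"
    and fix_block: "\<And>r. r < q \<Longrightarrow> \<pi> (a + r) = a + r"
  shows "block_gen a s \<odot> perm_aut n \<pi> = perm_aut n \<pi> \<odot> block_gen a s"
  using block_gen_conj[OF \<pi> q q(3) fix_block] by simp

lemma block_gen_commute:
  assumes q: "2 \<le> q" "s < q" "s' < q" "a + q \<le> b" "b + q \<le> n"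
  shows "block_gen a s \<odot> block_gen b s' = block_gen b s' \<odot> block_gen a s"
proof -
  have t: "Transposition.transpose (a + s - 1) (a + s) permutes {..<n}"
    "Transposition.transpose (b + s' - 1) (b + s') permutes {..<n}"
    using q by (auto intro!: permutes_swap_id)
  consider "s = 0" "s' = 0" | "s' \<noteq> 0" | "s \<noteq> 0" by blast
  then show ?thesis
  proof cases
    case 1
    then show ?thesis using q by (auto simp: block_gen_def intro!: partial_conj_commute)
  next
    case 2
    have "block_gen b s' = perm_aut n (Transposition.transpose (b + s' - 1) (b + s'))"
      using 2 by (simp add: block_gen_def)
    moreover have "Transposition.transpose (b + s' - 1) (b + s') (a + r) = a + r" if "r < q" for r
      using q 2 that by (intro transpose_apply_other) auto
    ultimately show ?thesis using block_gen_perm_commute[OF t(2) q(1,2)] q by simp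
  next
    case 3
    have "block_gen a s = perm_aut n (Transposition.transpose (a + s - 1) (a + s))"
      using 3 by (simp add: block_gen_def)
    moreover have "Transposition.transpose (a + s - 1) (a + s) (b + r) = b + r" if "r < q" for r
      using q 3 that by (intro transpose_apply_other) auto
    ultimately show ?thesis using block_gen_perm_commute[OF t(1) q(1,3)] q by simp
  qed
qed

lemma fixable_block_shift:
  assumes q: "2 \<le> q" "a + q \<le> n" "b + q \<le> n" and \<pi>: "\<pi> permutes {..<n}"
    and shift: "\<And>r. r < q \<Longrightarrow> \<pi> (a + r) = b + r"
    and fa: "fixable (block_gen a ` {..<q})"
  shows "fixable (block_gen b ` {..<q})"
proof -
  obtain x where x: "x \<in> M" "\<And>s. s < q \<Longrightarrow> \<rho> (block_gen a s) x = x" using fa by (auto simp: fixable_def)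
  have p: "perm_aut n \<pi> \<in> auto (UCox n)" using \<pi> by (rule perm_aut_auto)
  have "\<rho> (block_gen b s) (\<rho> (perm_aut n \<pi>) x) = \<rho> (perm_aut n \<pi>) x" if s: "s < q" for s
    using act_mult[OF p block_gen_auto[OF q(1) s q(2)] x(1)]
      act_mult[OF block_gen_auto[OF q(1) s q(3)] p x(1)]
      block_gen_conj[OF \<pi> q(1) s q(2,3) shift] x(2)[OF s] by simp
  then show ?thesis unfolding fixable_def using act_in[OF p x(1)] by (intro bexI) auto
qed

text \<open>The blocks at 0 and at \<open>a\<close> are equal or disjoint, so exchanging them is a
  well-defined involution.\<close>

lemma block_swap_exists:
  assumes "a = 0 \<or> q \<le> a" "a + q \<le> n"
  obtains \<pi> where "\<pi> permutes {..<n}" "\<And>r. r < q \<Longrightarrow> \<pi> r = a + r" "\<And>r. r < q \<Longrightarrow> \<pi> (a + r) = r"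
proof
  define \<pi> where "\<pi> x = (if x < q then a + x else if a \<le> x \<and> x < a + q then x - a else x)" for x
  have inv: "\<pi> (\<pi> x) = x" for x using assms by (auto simp: \<pi>_def)
  have "bij_betw \<pi> {..<n} {..<n}"
    by (rule bij_betw_byWitness[where f' = \<pi>]) (use inv assms in \<open>auto simp: \<pi>_def\<close>)
  then show "\<pi> permutes {..<n}"
    by (rule bij_imp_permutes) (use assms in \<open>auto simp: \<pi>_def\<close>)
  show "\<pi> r = a + r" "\<pi> (a + r) = r" if "r < q" for r
    using assms that by (auto simp: \<pi>_def)
qed

text \<open>Without generator 0 only permutations remain. Without generator 1 the letter
  \<open>a\<close> is never moved, so the rest lies in the star at \<open>a\<close>. Without
  \<open>v \<ge> 2\<close> the block splits into its first \<open>v\<close> letters, covered by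
  \<open>smaller\<close>, and a symmetric group on the others.\<close>

lemma fixable_block_minus:
  assumes q: "2 \<le> q" "a + q \<le> n" "v < q"
    and smaller: "\<And>r. 2 \<le> r \<Longrightarrow> r < q \<Longrightarrow> fixable (block_gen a ` {..<r})"
  shows "fixable (block_gen a ` ({..<q} - {v}))"
proof -
  have t: "Transposition.transpose (a + s - 1) (a + s) permutes {..<n}" if "s < q" for s
    using q that by (auto intro!: permutes_swap_id)
  consider "v = 0" | "v = 1" | "2 \<le> v" by linarith
  then show ?thesis
  proof cases
    case 1
    show ?thesis
      by (rule fixable_mono[OF fixable_perms]) (use t 1 in \<open>auto simp: block_gen_def\<close>)
  next
    case 2
    have "block_gen a s \<in> partial_conj n a ` ({..<n} - {a}) \<union> perm_aut n ` {\<pi>. \<pi> permutes {..<n} - {a}}"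
      if "s < q" "s \<noteq> 1" for s
    proof (cases "s = 0")
      case True
      then show ?thesis using q by (auto simp: block_gen_def)
    next
      case False
      then have "Transposition.transpose (a + s - 1) (a + s) permutes {..<n} - {a}"
        using that q by (intro permutes_swap_id) auto
      then show ?thesis using False by (auto simp: block_gen_def)
    qed
    then show ?thesis
      using q 2 by (intro fixable_mono[OF fixable_star[of a]]) auto
  next
    case 3
    let ?T = "(\<lambda>s. perm_aut n (Transposition.transpose (a + s - 1) (a + s))) ` {v<..<q}"
    have "fixable (block_gen a ` {..<v} \<union> ?T)"
    proof (rule fixable_Un)
      show "block_gen a ` {..<v} \<subseteq> auto (UCox n)" using q 3 block_gen_auto[of v _ a] by auto
      show "?T \<subseteq> auto (UCox n)" using t perm_aut_auto by auto
      show "fixable (block_gen a ` {..<v})" using smaller 3 q by blast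
      show "fixable ?T" by (rule fixable_mono[OF fixable_perms]) (use t in auto)
      fix g h assume "g \<in> block_gen a ` {..<v}" "h \<in> ?T"
      then obtain r s where rs: "g = block_gen a r" "r < v" "v < s" "s < q"
        "h = perm_aut n (Transposition.transpose (a + s - 1) (a + s))" by auto
      show "g \<odot> h = h \<odot> g" unfolding rs(1,5)
        by (rule block_gen_perm_commute[OF t[OF rs(4)] 3 rs(2)])
          (use rs q in \<open>auto intro!: transpose_apply_other\<close>)
    qed
    moreover have "block_gen a s \<in> block_gen a ` {..<v} \<union> ?T" if "s < q" "s \<noteq> v" for s
      using that 3 by (cases "s < v") (auto simp: block_gen_def)
    ultimately show ?thesis by (elim fixable_mono) auto
  qed
qed

text \<open>From \<open>n < (n div q + 1) * q\<close> one gets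
  \<open>n \<le> 2 * (n div q) * (q - 1) + 1\<close>.\<close>

lemma half_le_blocks:
  assumes "2 \<le> q" "q \<le> n"
  shows "n div 2 \<le> n div q * (q - 1)"
proof -
  obtain l where l: "n div q = Suc l" using assms by (cases "n div q") (auto simp: div_eq_0_iff)
  obtain p where p: "q = Suc (Suc p)" using assms by (cases q; cases "q - 1") auto
  have "n < Suc (n div q) * q" using dividend_less_div_times[of q n] assms by (simp add: add.commute)
  then have "n < Suc (Suc l) * Suc (Suc p)" by (simp only: l[symmetric] p[symmetric])
  then have "n \<le> 2 * (Suc l * Suc p) + 1" by (simp add: algebra_simps)
  then have "n div 2 \<le> Suc l * Suc p" by simp
  then show ?thesis by (simp only: l) (simp add: p)
qed

lemma fixable_block:
  assumes dim: "covering_dim_le mtopology (int m)" and m: "m < n div 2"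
    and "2 \<le> q" "a = 0 \<or> q \<le> a" "a + q \<le> n"
  shows "fixable (block_gen a ` {..<q})"
  using assms(3-)
proof (induction q arbitrary: a rule: less_induct)
  case (less q)
  note q = less.prems(1)
  show ?case
  proof (rule ccontr)
    assume not: "\<not> fixable (block_gen a ` {..<q})"
    \<comment> \<open>Any two of these blocks are conjugate through the initial one.\<close>
    have none: "\<not> fixable (block_gen b ` {..<q})" if b: "b = 0 \<or> q \<le> b" "b + q \<le> n" for b
    proof
      assume fb: "fixable (block_gen b ` {..<q})"
      obtain \<pi> where \<pi>: "\<pi> permutes {..<n}" "\<And>r. r < q \<Longrightarrow> \<pi> (b + r) = r"
        by (rule block_swap_exists[OF b]) blast
      obtain \<pi>' where \<pi>': "\<pi>' permutes {..<n}" "\<And>r. r < q \<Longrightarrow> \<pi>' r = a + r"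
        by (rule block_swap_exists[OF less.prems(2,3)]) blast
      have "fixable (block_gen 0 ` {..<q})"
        by (rule fixable_block_shift[OF q b(2) _ \<pi>(1) _ fb]) (use b \<pi>(2) in auto)
      then have "fixable (block_gen a ` {..<q})"
        by (intro fixable_block_shift[OF q _ less.prems(3) \<pi>'(1), of 0]) (use b \<pi>'(2) in auto)
      then show False using not by blast
    qed
    define l where "l = n div q"
    have blk: "i * q = 0 \<or> q \<le> i * q" "i * q + q \<le> n" if "i < l" for i
    proof -
      have "Suc i * q \<le> n div q * q" using that unfolding l_def by (intro mult_le_mono1) simp
      also have "\<dots> \<le> n" by simp
      finally show "i * q + q \<le> n" by simp
      show "i * q = 0 \<or> q \<le> i * q" by (cases i) auto
    qed
    define C where "C i s = {x \<in> M. \<rho> (block_gen (i * q) s) x = x}" for i s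
    have iso: "isometry (\<rho> (block_gen (i * q) s))" if "i < l" "s \<le> q - 1" for i s
      by (rule act_isometry[OF block_gen_auto[OF q _ blk(2)[OF that(1)]]]) (use that q in auto)
    show False
    proof (rule product_helly[of l "q - 1" C m])
      show "geod_convex (C i s)" "closedin mtopology (C i s)" if "i < l" "s \<le> q - 1" for i s
        unfolding C_def using iso[OF that] by (auto intro: geod_convex_fixed closedin_fixed)
      show "\<exists>s\<le>q - 1. x \<notin> C i s" if "i < l" "x \<in> M" for i x
      proof (rule ccontr)
        assume "\<not> (\<exists>s\<le>q - 1. x \<notin> C i s)"
        then have "fixable (block_gen (i * q) ` {..<q})"
          unfolding fixable_def C_def using that(2) q by (intro bexI[of _ x]) auto
        then show False using none blk[OF that(1)] by blast
      qed
      show "\<exists>x\<in>M. \<forall>i<l. \<forall>s\<le>q - 1. s \<noteq> v i \<longrightarrow> x \<in> C i s" if v: "\<And>i. i < l \<Longrightarrow> v i \<le> q - 1" for v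
      proof -
        define X where "X i = block_gen (i * q) ` ({..<q} - {v i})" for i
        have X_auto: "X i \<subseteq> auto (UCox n)" if "i < l" for i
          unfolding X_def using block_gen_auto[OF q _ blk(2)[OF that]] by auto
        have X_fix: "fixable (X i)" if "i < l" for i
          unfolding X_def
        proof (rule fixable_block_minus[OF q blk(2)[OF that]])
          show "v i < q" using v[OF that] q by linarith
          \<comment> \<open>The shorter blocks start at every offset \<open>i * q\<close>, which is
            why the induction generalises over \<open>a\<close>.\<close>
          show "fixable (block_gen (i * q) ` {..<r})" if r: "2 \<le> r" "r < q" for r
          proof (rule less.IH[OF r(2,1)])
            show "i * q = 0 \<or> r \<le> i * q" "i * q + r \<le> n" using blk[OF \<open>i < l\<close>] r by linarith+
          qed
        qed
        \<comment> \<open>One block is added at a time; generators of different blocks commute,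
          whichever generator each block omits.\<close>
        have "fixable (\<Union>i<j. X i)" if "j \<le> l" for j
          using that
        proof (induction j)
          case (Suc j)
          have "fixable ((\<Union>i<j. X i) \<union> X j)"
          proof (rule fixable_Un)
            show "(\<Union>i<j. X i) \<subseteq> auto (UCox n)" "X j \<subseteq> auto (UCox n)"
              using Suc.prems by (auto intro!: UN_least X_auto)
            show "fixable (\<Union>i<j. X i)" "fixable (X j)" using Suc X_fix by auto
            fix g h assume "g \<in> (\<Union>i<j. X i)" "h \<in> X j"
            then obtain i s s' where iss: "i < j" "s < q" "s' < q" "g = block_gen (i * q) s" "h = block_gen (j * q) s'"
              by (auto simp: X_def)
            have "Suc i * q \<le> j * q" using iss(1) by (intro mult_le_mono1) simp
            then show "g \<odot> h = h \<odot> g" unfolding iss(4,5)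
              using block_gen_commute[OF q iss(2,3)] blk(2)[of j] Suc.prems by simp
          qed
          then show ?case by (simp add: lessThan_Suc Un_commute)
        qed (simp add: fixable_empty)
        from this[OF order_refl] obtain x where x: "x \<in> M" "\<And>i g. i < l \<Longrightarrow> g \<in> X i \<Longrightarrow> \<rho> g x = x"
          by (auto simp: fixable_def)
        then show ?thesis using q by (intro bexI[of _ x]) (auto simp: C_def X_def)
      qed
      show "m < l * (q - 1)" using m half_le_blocks[of q] q less.prems by (auto simp: l_def)
    qed (rule dim)
  qed
qed

text \<open>The stabiliser of \<open>x\<close> contains the adjacent transpositions, hence all
  permutations; conjugating the one partial conjugation by them gives all others, and Nielsen
  reduction reaches every automorphism.\<close>

lemma fixed_by_block_imp_fixed:
  assumes x: "x \<in> M" and gen: "\<And>s. s < n \<Longrightarrow> \<rho> (block_gen 0 s) x = x"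
    and \<alpha>: "\<alpha> \<in> auto (UCox n)"
  shows "\<rho> \<alpha> x = x"
proof -
  define P where "P \<pi> \<longleftrightarrow> \<pi> permutes {..<n} \<and> \<rho> (perm_aut n \<pi>) x = x" for \<pi>
  have P_comp: "P (\<pi> \<circ> \<pi>')" if "P \<pi>" "P \<pi>'" for \<pi> \<pi>'
    using that act_mult[of "perm_aut n \<pi>" "perm_aut n \<pi>'" x] x
    by (simp add: P_def perm_aut_auto permutes_compose perm_aut_compose)
  have adj: "P (Transposition.transpose i (Suc i))" if "Suc i < n" for i
    using gen[OF that] that by (auto simp: P_def block_gen_def intro!: permutes_swap_id)
  have "P id"
    using P_comp[OF adj[of 0] adj[of 0]] n2 by (simp add: id_def[symmetric])
  have trans_up: "P (Transposition.transpose i (i + k))" if "i + k < n" for i k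
    using that
  proof (induction k)
    case 0
    then show ?case using \<open>P id\<close> by (simp add: id_def)
  next
    case (Suc k)
    show ?case
    proof (cases "k = 0")
      case True
      then show ?thesis using adj[of i] Suc.prems by simp
    next
      case False
      have eq: "Transposition.transpose i (i + Suc k) = Transposition.transpose (i + k) (Suc (i + k))
         \<circ> (Transposition.transpose i (i + k) \<circ> Transposition.transpose (i + k) (Suc (i + k)))"
        using False by (auto simp: fun_eq_iff Transposition.transpose_def)
      show ?thesis unfolding eq by (intro P_comp adj Suc.IH) (use Suc.prems in auto)
    qed
  qed
  have trans: "P (Transposition.transpose i j)" if "i < n" "j < n" for i j
  proof (cases "i \<le> j")
    case True
    then show ?thesis using trans_up[of i "j - i"] that by simp
  next
    case False
    then show ?thesis using trans_up[of j "i - j"] that by (simp add: transpose_commute)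
  qed
  have perms: "P \<pi>" if "\<pi> permutes {..<n}" for \<pi>
    using that finite_lessThan
  proof (induction rule: permutes_induct)
    case (swap a b p)
    then show ?case by (intro P_comp trans) auto
  qed (rule \<open>P id\<close>)
  have \<sigma>: "\<rho> (partial_conj n a b) x = x" if ab: "a < n" "b < n" "a \<noteq> b" for a b
  proof -
    \<comment> \<open>\<open>c\<close> is where \<open>1\<close> lands under the exchange of
      \<open>0\<close> and \<open>a\<close>; the exchange of \<open>c\<close> and \<open>b\<close>
      then sends it to \<open>b\<close> and leaves \<open>a\<close> alone.\<close>
    define c where "c = Transposition.transpose 0 a 1"
    define \<pi> where "\<pi> = Transposition.transpose c b \<circ> Transposition.transpose 0 a"
    have c: "c < n" "c \<noteq> a" using ab n2 by (auto simp: c_def Transposition.transpose_def)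
    have \<pi>: "\<pi> permutes {..<n}" unfolding \<pi>_def
      using c ab by (intro permutes_compose permutes_swap_id) auto
    have "\<pi> 0 = a" "\<pi> 1 = b" using c ab by (auto simp: \<pi>_def c_def[unfolded One_nat_def, symmetric])
    then have "perm_aut n \<pi> \<odot> partial_conj n 0 1 = partial_conj n a b \<odot> perm_aut n \<pi>"
      using perm_aut_partial_conj[OF \<pi>, of 0 1] n2 by simp
    moreover have "\<rho> (perm_aut n \<pi>) x = x" "\<rho> (partial_conj n 0 1) x = x"
      using perms[OF \<pi>] gen[of 0] n2 by (auto simp: P_def block_gen_def)
    moreover have "partial_conj n 0 1 \<in> auto (UCox n)" "partial_conj n a b \<in> auto (UCox n)"
      using ab n2 by (auto intro: partial_conj_auto)
    ultimately show ?thesis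
      using act_mult[of "perm_aut n \<pi>" "partial_conj n 0 1" x]
        act_mult[of "partial_conj n a b" "perm_aut n \<pi>" x] x perm_aut_auto[OF \<pi>] by simp
  qed
  from \<alpha> show ?thesis
  proof (induction rule: auto_UCox_induct)
    case (perm \<pi>)
    then show ?case using perms by (simp add: P_def)
  next
    case (conj \<alpha> a b)
    then show ?case using act_mult[of \<alpha> "partial_conj n a b" x] x \<sigma> partial_conj_auto by simp
  qed
qed

end

theorem theoremA:
  fixes n d :: nat
    and M :: "'x set" and dm :: "'x \<Rightarrow> 'x \<Rightarrow> real"
    and \<rho> :: "(nat list \<Rightarrow> nat list) \<Rightarrow> 'x \<Rightarrow> 'x"
  assumes "n \<ge> 4"
    and "d < n div 2"
    and "CAT0_space M dm"
    and "Metric_space.mcomplete M dm"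
    and "covering_dim_eq (Metric_space.mtopology M dm) d"
    and "isometric_action (AutoGroup (UCox n)) M dm \<rho>"
  shows "has_fixed_point (AutoGroup (UCox n)) M \<rho>"
proof -
  obtain G where G: "CAT0_geodesics M dm G" using CAT0_space_geodesics[OF assms(3)] .
  interpret CAT0_geodesics M dm G by (rule G)
  have dim: "covering_dim_le mtopology (int d)" using assms(5) by (simp add: covering_dim_eq_def)
  \<comment> \<open>The lower bound in \<open>covering_dim_eq\<close> excludes the empty space,
    where the empty family refines every cover.\<close>
  have "M \<noteq> {}"
  proof
    assume "M = {}"
    then have "topspace mtopology = {}" by (rule trans[OF topspace_mtopology])
    then have "covering_dim_le mtopology (int d - 1)"
      unfolding covering_dim_le_def by (auto intro!: exI[of _ "{}"] simp del: topspace_mtopology)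
    then show False using assms(5) by (simp add: covering_dim_eq_def)
  qed
  then interpret aut_action M dm G n \<rho>
    by unfold_locales (use assms in auto)
  have "fixable (block_gen 0 ` {..<n})"
    by (rule fixable_block[OF dim assms(2)]) (use assms(1) in auto)
  then obtain x where "x \<in> M" "\<And>s. s < n \<Longrightarrow> \<rho> (block_gen 0 s) x = x"
    by (auto simp: fixable_def)
  then show ?thesis
    unfolding has_fixed_point_def AutoGroup_carrier
    using fixed_by_block_imp_fixed by blast
qed

end
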